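(* In the setting described in the context, $\rho(G(a,b))=\max\{1,\tfrac{3}{d}\}$.
   Context: Let $p\geq5$ be a prime and $G\leq\mathrm{Sym}(\Omega)$ transitive with $|\Omega|=3p$, whose only non-trivial $G$-invariant partition is $\mathcal{B}=\{B_1,\dots,B_p\}$ with $|B_i|=3$. Let $\overline{G}\leq\mathrm{Sym}(\mathcal{B})$ be the induced group and $K=\ker(G\to\overline{G})$. Assume $K\neq1$, $K$ contains no derangement (every element of $K$ fixes a point), every minimal normal subgroup of $G$ contained in $K$ is an elementary abelian $3$-group, and $K$ contains an involution. Assume $\overline{G}$ is solvable: $\overline{G}=\langle\alpha\rangle\rtimes\langle\beta\rangle\leq\mathrm{AGL}(1,p)$ with $\alpha$ a $p$-cycle, $o(\beta)=d\mid p-1$, $\beta$ fixing $B_1$, $\beta\alpha\beta^{-1}=\alpha^t$ with $\gcd(t,p)=1$. Let $a\in G$ be a semiregular element of order $p$ (a product of three $p$-cycles) with image $\alpha$ and $b\in G$ with image $\beta$. Let $G(a,b)=\langle K,a,b\rangle$. For a transitive group $H\leq\mathrm{Sym}(\Omega)$, $\rho(H)=\max\{|\mathcal{F}|:\mathcal{F}\subseteq H\text{ intersecting}\}/|H_\omega|$, where $\mathcal{F}$ is intersecting if any two of its elements agree on some point of $\Omega$. *)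

theory Defs
  imports
    "HOL-Algebra.Group_Action"
    "HOL-Algebra.Solvable_Groups"
    "HOL-Number_Theory.Residues"
    "HOL-Library.Disjoint_Sets"
    "HOL-Combinatorics.Cycles"
begin

text \<open>
  \<open>Sym(\<Omega>)\<close> is the library group \<^term>\<open>BijGroup \<Omega>\<close>, with \<open>(g h)(x) = g (h x)\<close>. A permutation
  group on \<open>\<Omega>\<close> is given by its underlying set \<open>H\<close>; \<open>perm_group \<Omega> H\<close> is the same thing as
  a group record.
\<close>

abbreviation perm_group :: "'a set \<Rightarrow> ('a \<Rightarrow> 'a) set \<Rightarrow> ('a \<Rightarrow> 'a) monoid" where
  "perm_group \<Omega> H \<equiv> (BijGroup \<Omega>)\<lparr>carrier := H\<rparr>"

definition transitive_on :: "'a set \<Rightarrow> ('a \<Rightarrow> 'a) set \<Rightarrow> bool" where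
  "transitive_on \<Omega> G \<longleftrightarrow> transitive_action (perm_group \<Omega> G) \<Omega> (\<lambda>g. g)"

definition derangement :: "'a set \<Rightarrow> ('a \<Rightarrow> 'a) \<Rightarrow> bool" where
  "derangement \<Omega> g \<longleftrightarrow> (\<forall>x\<in>\<Omega>. g x \<noteq> x)"

definition semiregular :: "'a set \<Rightarrow> ('a \<Rightarrow> 'a) \<Rightarrow> bool" where
  "semiregular \<Omega> g \<longleftrightarrow>
     (\<forall>h \<in> generate (BijGroup \<Omega>) {g}. h \<noteq> \<one>\<^bsub>BijGroup \<Omega>\<^esub> \<longrightarrow> derangement \<Omega> h)"

definition is_cycle_of_length :: "'a set \<Rightarrow> nat \<Rightarrow> ('a \<Rightarrow> 'a) \<Rightarrow> bool" where
  "is_cycle_of_length \<Omega> n g \<longleftrightarrow>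
     (\<exists>cs. cycle cs \<and> length cs = n \<and> set cs \<subseteq> \<Omega> \<and> g = restrict (cycle_of_list cs) \<Omega>)"

definition nontrivial_invariant_partition :: "'a set \<Rightarrow> ('a \<Rightarrow> 'a) set \<Rightarrow> 'a set set \<Rightarrow> bool" where
  "nontrivial_invariant_partition \<Omega> G P \<longleftrightarrow>
     partition_on \<Omega> P \<and> (\<forall>g\<in>G. \<forall>B\<in>P. g ` B \<in> P) \<and>
     P \<noteq> {\<Omega>} \<and> P \<noteq> (\<lambda>x. {x}) ` \<Omega>"

definition block_perm :: "'a set set \<Rightarrow> ('a \<Rightarrow> 'a) \<Rightarrow> 'a set \<Rightarrow> 'a set" where
  "block_perm P g = (\<lambda>B\<in>P. g ` B)"

definition induced_group :: "'a set set \<Rightarrow> ('a \<Rightarrow> 'a) set \<Rightarrow> ('a set \<Rightarrow> 'a set) set" where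
  "induced_group P G = block_perm P ` G"

definition block_kernel :: "'a set \<Rightarrow> 'a set set \<Rightarrow> ('a \<Rightarrow> 'a) set \<Rightarrow> ('a \<Rightarrow> 'a) set" where
  "block_kernel \<Omega> P G = kernel (perm_group \<Omega> G) (BijGroup P) (block_perm P)"

definition minimal_normal :: "'g set \<Rightarrow> ('g, 'm) monoid_scheme \<Rightarrow> bool" where
  "minimal_normal N G \<longleftrightarrow>
     N \<lhd> G \<and> N \<noteq> {\<one>\<^bsub>G\<^esub>} \<and>
     (\<forall>M. M \<lhd> G \<and> M \<subseteq> N \<longrightarrow> M = {\<one>\<^bsub>G\<^esub>} \<or> M = N)"

definition elementary_abelian :: "nat \<Rightarrow> ('g, 'm) monoid_scheme \<Rightarrow> bool" where
  "elementary_abelian q G \<longleftrightarrow> comm_group G \<and> (\<forall>x\<in>carrier G. x [^]\<^bsub>G\<^esub> q = \<one>\<^bsub>G\<^esub>)"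

text \<open>\<open>G = N \<rtimes> H\<close> as an internal semidirect product.\<close>

definition internal_semidirect :: "('g, 'm) monoid_scheme \<Rightarrow> 'g set \<Rightarrow> 'g set \<Rightarrow> bool" where
  "internal_semidirect G N H \<longleftrightarrow>
     N \<lhd> G \<and> subgroup H G \<and> N \<inter> H = {\<one>\<^bsub>G\<^esub>} \<and> N <#>\<^bsub>G\<^esub> H = carrier G"

definition AGL1 :: "('r, 'm) ring_scheme \<Rightarrow> ('r \<Rightarrow> 'r) set" where
  "AGL1 R = {(\<lambda>x\<in>carrier R. (c \<otimes>\<^bsub>R\<^esub> x) \<oplus>\<^bsub>R\<^esub> e) | c e. c \<in> Units R \<and> e \<in> carrier R}"

text \<open>
  A permutation group \<open>H\<close> on \<open>\<Omega>\<close> is contained in a permutation group \<open>L\<close> on \<open>\<Delta>\<close> up to an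
  identification \<open>f\<close> of \<open>\<Omega>\<close> with \<open>\<Delta>\<close>.
\<close>

definition perm_embeds ::
    "'x set \<Rightarrow> ('x \<Rightarrow> 'x) set \<Rightarrow> 'y set \<Rightarrow> ('y \<Rightarrow> 'y) set \<Rightarrow> bool" where
  "perm_embeds \<Omega> H \<Delta> L \<longleftrightarrow>
     (\<exists>f. bij_betw f \<Omega> \<Delta> \<and> (\<forall>g\<in>H. \<exists>k\<in>L. \<forall>x\<in>\<Omega>. f (g x) = k (f x)))"

definition intersecting :: "'a set \<Rightarrow> ('a \<Rightarrow> 'a) set \<Rightarrow> bool" where
  "intersecting \<Omega> F \<longleftrightarrow> (\<forall>f\<in>F. \<forall>g\<in>F. \<exists>x\<in>\<Omega>. f x = g x)"

text \<open>
  The intersection density. The base point \<open>\<omega>\<close> only enters through the order of its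
  stabilizer, which does not depend on \<open>\<omega> \<in> \<Omega>\<close> when \<open>H\<close> is transitive.
\<close>

definition intersection_density :: "'a set \<Rightarrow> ('a \<Rightarrow> 'a) set \<Rightarrow> 'a \<Rightarrow> real" where
  "intersection_density \<Omega> H \<omega> =
     real (Max {card F | F. F \<subseteq> H \<and> intersecting \<Omega> F})
       / real (card (stabilizer (perm_group \<Omega> H) (\<lambda>g. g) \<omega>))"

end

theory Submission
  imports Defs
begin

text \<open>
  Label the three points of every block by \<open>0, 1, 2\<close> so that \<open>a\<close> preserves labels. Then every
  \<open>g \<in> G\<close> maps a block \<open>B\<close> to \<open>g B\<close> by \<open>i \<mapsto> \<eta> i + c\<close> modulo 3, with a sign
  \<open>\<eta> = \<eta>(g, B)\<close>. If some \<open>k \<in> K\<close> had a non-constant sign, then, as \<open>p\<close> is prime, the signs of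
  elements of \<open>K\<close> would separate any two blocks; products of a 3-element with its conjugates
  would then give elements of \<open>K\<close> that are 3-cycles on one block and trivial elsewhere, hence a
  derangement in \<open>K\<close>. So for \<open>g \<in> K\<close> the sign \<open>\<eta>(g, B)\<close> does not depend on \<open>B\<close>, and neither does
  it for \<open>g \<in> G\<close>, because \<open>\<langle>\<alpha>\<rangle>\<close> is normal and \<open>p\<close> is odd.

  Let \<open>F\<close> be intersecting. Within one coset of the preimage of \<open>\<langle>\<alpha>\<rangle>\<close> it lies in a single coset of
  \<open>K\<close>. Two members in different cosets agree over the unique block fixed by their quotient, and
  if their signs are equal, they agree on that whole block. So for each sign either \<open>F\<close> meets only
  one of the \<open>d\<close> cosets, or it meets each of them in at most \<open>|K|/6\<close> elements, giving
  \<open>|F| \<le> max(|K|, d |K|/3)\<close>. The bound is attained by \<open>K\<close> or by a point stabilizer.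
\<close>

section \<open>Permutation groups preserving a system of triples\<close>

locale triple_system =
  fixes \<Omega> :: "'a set" and G :: "('a \<Rightarrow> 'a) set" and \<B> :: "'a set set"
  assumes finite_points: "finite \<Omega>"
    and subgroup_G: "subgroup G (BijGroup \<Omega>)"
    and partition: "partition_on \<Omega> \<B>"
    and image_block: "\<And>g B. g \<in> G \<Longrightarrow> B \<in> \<B> \<Longrightarrow> g ` B \<in> \<B>"
    and card_block: "\<And>B. B \<in> \<B> \<Longrightarrow> card B = 3"
begin

sublocale Sym: group "BijGroup \<Omega>"
  by (rule group_BijGroup)

abbreviation times_perm (infixl "\<cdot>" 70) where
  "g \<cdot> h \<equiv> g \<otimes>\<^bsub>BijGroup \<Omega>\<^esub> h"

abbreviation iv :: "('a \<Rightarrow> 'a) \<Rightarrow> 'a \<Rightarrow> 'a" where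
  "iv g \<equiv> inv\<^bsub>BijGroup \<Omega>\<^esub> g"

abbreviation pw :: "('a \<Rightarrow> 'a) \<Rightarrow> nat \<Rightarrow> 'a \<Rightarrow> 'a" where
  "pw g n \<equiv> g [^]\<^bsub>BijGroup \<Omega>\<^esub> n"

text \<open>The kernel of the action on blocks in elementwise form; \<open>block_kernel_eq\<close>
  identifies it with \<open>block_kernel\<close>.\<close>

definition K :: "('a \<Rightarrow> 'a) set" where
  "K = {g \<in> G. \<forall>B\<in>\<B>. g ` B = B}"

lemma G_carrier: "g \<in> G \<Longrightarrow> g \<in> carrier (BijGroup \<Omega>)"
  using subgroup.subset[OF subgroup_G] by auto

lemma K_G: "k \<in> K \<Longrightarrow> k \<in> G"
  by (simp add: K_def)

lemma K_image: "k \<in> K \<Longrightarrow> B \<in> \<B> \<Longrightarrow> k ` B = B"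
  by (simp add: K_def)

lemma K_app: "k \<in> K \<Longrightarrow> B \<in> \<B> \<Longrightarrow> x \<in> B \<Longrightarrow> k x \<in> B"
  using K_image by blast

lemma G_bij: "g \<in> G \<Longrightarrow> bij_betw g \<Omega> \<Omega>"
  using G_carrier[of g] by (simp add: BijGroup_def Bij_def)

lemma G_ext: "g \<in> G \<Longrightarrow> g \<in> extensional \<Omega>"
  using G_carrier[of g] by (simp add: BijGroup_def Bij_def)

lemma G_eqI: "g \<in> G \<Longrightarrow> h \<in> G \<Longrightarrow> (\<And>x. x \<in> \<Omega> \<Longrightarrow> g x = h x) \<Longrightarrow> g = h"
  using G_ext extensionalityI by blast

lemma mult_closed [simp]: "g \<in> G \<Longrightarrow> h \<in> G \<Longrightarrow> g \<cdot> h \<in> G"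
  by (rule subgroup.m_closed[OF subgroup_G])

lemma iv_closed [simp]: "g \<in> G \<Longrightarrow> iv g \<in> G"
  by (rule subgroup.m_inv_closed[OF subgroup_G])

lemma one_closed [simp]: "\<one>\<^bsub>BijGroup \<Omega>\<^esub> \<in> G"
  by (rule subgroup.one_closed[OF subgroup_G])

lemma pw_closed [simp]: "g \<in> G \<Longrightarrow> pw g n \<in> G"
  by (induction n) simp_all

lemma one_app [simp]: "x \<in> \<Omega> \<Longrightarrow> \<one>\<^bsub>BijGroup \<Omega>\<^esub> x = x"
  by (simp add: BijGroup_def)

lemma mult_app [simp]: "g \<in> G \<Longrightarrow> h \<in> G \<Longrightarrow> x \<in> \<Omega> \<Longrightarrow> (g \<cdot> h) x = g (h x)"
  using G_carrier[of g] G_carrier[of h] by (simp add: BijGroup_def compose_def)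

lemma app_in [simp]: "g \<in> G \<Longrightarrow> x \<in> \<Omega> \<Longrightarrow> g x \<in> \<Omega>"
  using G_bij[of g] bij_betwE by blast

lemma iv_app [simp]: "g \<in> G \<Longrightarrow> x \<in> \<Omega> \<Longrightarrow> iv g (g x) = x"
  using Sym.l_inv[OF G_carrier[of g]] mult_app[of "iv g" g x] by simp

lemma app_iv [simp]: "g \<in> G \<Longrightarrow> x \<in> \<Omega> \<Longrightarrow> g (iv g x) = x"
  using Sym.r_inv[OF G_carrier[of g]] mult_app[of g "iv g" x] by simp

lemma app_inj: "g \<in> G \<Longrightarrow> x \<in> \<Omega> \<Longrightarrow> y \<in> \<Omega> \<Longrightarrow> g x = g y \<Longrightarrow> x = y"
  by (metis iv_app)

lemma block_sub: "B \<in> \<B> \<Longrightarrow> x \<in> B \<Longrightarrow> x \<in> \<Omega>"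
  using partition by (auto simp: partition_on_def)

lemma in_some_block: "x \<in> \<Omega> \<Longrightarrow> \<exists>B\<in>\<B>. x \<in> B"
  using partition by (auto simp: partition_on_def)

lemma block_eq: "B \<in> \<B> \<Longrightarrow> B' \<in> \<B> \<Longrightarrow> x \<in> B \<Longrightarrow> x \<in> B' \<Longrightarrow> B = B'"
  using partition by (auto simp: partition_on_def disjoint_def)

lemma finite_blocks: "finite \<B>"
  using finite_elements[OF finite_points partition] .

lemma image_mult: "g \<in> G \<Longrightarrow> h \<in> G \<Longrightarrow> B \<in> \<B> \<Longrightarrow> (g \<cdot> h) ` B = g ` (h ` B)"
  unfolding image_image by (intro image_cong refl) (auto dest: block_sub)

lemma image_iv [simp]: "g \<in> G \<Longrightarrow> B \<in> \<B> \<Longrightarrow> iv g ` (g ` B) = B"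
  unfolding image_image using image_cong[of B B "\<lambda>x. iv g (g x)" "\<lambda>x. x"] block_sub by simp

lemma image_iv2 [simp]: "g \<in> G \<Longrightarrow> B \<in> \<B> \<Longrightarrow> g ` (iv g ` B) = B"
  unfolding image_image using image_cong[of B B "\<lambda>x. g (iv g x)" "\<lambda>x. x"] block_sub by simp

lemma fixed_point_block: "g \<in> G \<Longrightarrow> B \<in> \<B> \<Longrightarrow> x \<in> B \<Longrightarrow> g x \<in> B \<Longrightarrow> g ` B = B"
  by (metis block_eq image_block image_eqI)

lemma finite_G: "finite G"
proof -
  have "finite (\<Pi>\<^sub>E x\<in>\<Omega>. \<Omega>)"
    by (intro finite_PiE finite_points)
  moreover have "G \<subseteq> (\<Pi>\<^sub>E x\<in>\<Omega>. \<Omega>)"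
    using G_ext by (auto simp: PiE_def)
  ultimately show ?thesis
    by (rule rev_finite_subset)
qed

lemma K_mult [simp]: "g \<in> K \<Longrightarrow> h \<in> K \<Longrightarrow> g \<cdot> h \<in> K"
  by (simp add: K_def image_mult)

lemma K_iv [simp]: "g \<in> K \<Longrightarrow> iv g \<in> K"
  using image_iv by (fastforce simp: K_def)

lemma K_one [simp]: "\<one>\<^bsub>BijGroup \<Omega>\<^esub> \<in> K"
  using image_cong[of _ _ "\<one>\<^bsub>BijGroup \<Omega>\<^esub>" "\<lambda>x. x"] block_sub by (simp add: K_def)

lemma K_conj: "g \<in> G \<Longrightarrow> k \<in> K \<Longrightarrow> g \<cdot> k \<cdot> iv g \<in> K"
proof -
  assume "g \<in> G" "k \<in> K"
  moreover have "(g \<cdot> k \<cdot> iv g) ` B = B" if "B \<in> \<B>" for B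
    using that calculation by (simp add: image_mult image_block K_image K_G)
  ultimately show ?thesis by (auto simp: K_def)
qed

lemma K_moves_point:
  assumes "k \<in> K" "k \<noteq> \<one>\<^bsub>BijGroup \<Omega>\<^esub>"
  shows "\<exists>x\<in>\<Omega>. k x \<noteq> x"
  using assms G_eqI[of k "\<one>\<^bsub>BijGroup \<Omega>\<^esub>"] K_G by auto

text \<open>The orbits of the normal subgroup \<open>K\<close> form a \<open>G\<close>-invariant
  partition. As \<open>K\<close> is non-trivial, it is not the partition into points; as orbits stay
  inside blocks of size 3, it is not \<open>{\<Omega>}\<close>. By uniqueness the orbits are the
  blocks.\<close>

lemma K_transitive_on_blocks:
  assumes "K \<noteq> {\<one>\<^bsub>BijGroup \<Omega>\<^esub>}" and "card \<Omega> > 3"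
    and unique: "\<And>P. nontrivial_invariant_partition \<Omega> G P \<Longrightarrow> P = \<B>"
    and "B \<in> \<B>" "x \<in> B" "y \<in> B"
  shows "\<exists>k\<in>K. k x = y"
proof -
  define orb where "orb x = (\<lambda>k. k x) ` K" for x
  have orb_sub: "orb x \<subseteq> \<Omega>" if "x \<in> \<Omega>" for x
    using that K_G by (auto simp: orb_def)
  have orb_self: "x \<in> orb x" if "x \<in> \<Omega>" for x
    using that unfolding orb_def by (metis K_one image_eqI one_app)
  have orb_mono: "orb y \<subseteq> orb x" if "x \<in> \<Omega>" "y \<in> orb x" for x y
  proof
    fix z assume "z \<in> orb y"
    with that obtain k k' where k: "k \<in> K" "k' \<in> K" "y = k x" "z = k' y"
      by (auto simp: orb_def)
    hence "z = (k' \<cdot> k) x" using that by (simp add: K_G)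
    thus "z \<in> orb x" using k K_mult by (auto simp: orb_def)
  qed
  have orb_sym: "x \<in> orb y" if "x \<in> \<Omega>" "y \<in> orb x" for x y
  proof -
    from that obtain k where k: "k \<in> K" "y = k x" by (auto simp: orb_def)
    hence "x = iv k y" using that by (simp add: K_G)
    thus ?thesis using k by (auto simp: orb_def)
  qed
  have orb_eq: "orb y = orb x" if "x \<in> \<Omega>" "y \<in> orb x" for x y
    using orb_mono[of x y] orb_mono[of y x] orb_sym[of x y] orb_sub[of x] that by blast
  \<comment> \<open>Normality of \<open>K\<close>: g (k x) = (g k g^-1) (g x).\<close>
  have orb_image: "g ` orb x = orb (g x)" if "g \<in> G" "x \<in> \<Omega>" for g x
  proof -
    have *: "g ` orb x \<subseteq> orb (g x)" if "g \<in> G" "x \<in> \<Omega>" for g x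
    proof
      fix z assume "z \<in> g ` orb x"
      then obtain k where k: "k \<in> K" "z = g (k x)" by (auto simp: orb_def)
      hence "z = (g \<cdot> k \<cdot> iv g) (g x)" using that by (simp add: K_G)
      thus "z \<in> orb (g x)" using K_conj[OF that(1) k(1)] by (auto simp: orb_def)
    qed
    have "orb (g x) \<subseteq> g ` orb x"
    proof
      fix z assume z: "z \<in> orb (g x)"
      hence "iv g z \<in> iv g ` orb (g x)" by blast
      also have "\<dots> \<subseteq> orb x" using *[of "iv g" "g x"] that by simp
      finally have "g (iv g z) \<in> g ` orb x" by blast
      moreover have "z \<in> \<Omega>" using z orb_sub[of "g x"] that by auto
      ultimately show "z \<in> g ` orb x" using that by simp
    qed
    with *[OF that] show ?thesis by blast
  qed
  define P where "P = orb ` \<Omega>"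
  have in_block: "orb x \<subseteq> B" if "B \<in> \<B>" "x \<in> B" for x B
    using that K_app by (auto simp: orb_def)
  have "partition_on \<Omega> P"
  proof (rule partition_onI)
    show "\<Union> P = \<Omega>"
      unfolding P_def using orb_sub orb_self by auto
    show "disjnt p q" if "p \<in> P" "q \<in> P" "p \<noteq> q" for p q
    proof -
      from that(1,2) obtain x y where xy: "x \<in> \<Omega>" "y \<in> \<Omega>" "p = orb x" "q = orb y"
        by (auto simp: P_def)
      have False if "z \<in> orb x" "z \<in> orb y" for z
        using orb_eq[of x z] orb_eq[of y z] xy that \<open>p \<noteq> q\<close> by auto
      thus ?thesis using xy by (auto simp: disjnt_def)
    qed
    show "{} \<notin> P" using orb_self by (auto simp: P_def)
  qed
  moreover have "g ` p \<in> P" if "g \<in> G" "p \<in> P" for g p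
    using that orb_image by (auto simp: P_def)
  moreover have "P \<noteq> {\<Omega>}"
  proof
    assume "P = {\<Omega>}"
    moreover have "x \<in> \<Omega>" using assms block_sub by blast
    ultimately have "orb x = \<Omega>" by (auto simp: P_def)
    with in_block[OF \<open>B \<in> \<B>\<close> \<open>x \<in> B\<close>] have "\<Omega> \<subseteq> B" by simp
    moreover have "finite B" using card_block[OF \<open>B \<in> \<B>\<close>] card.infinite by fastforce
    ultimately have "card \<Omega> \<le> card B" by (simp add: card_mono)
    thus False using card_block assms by simp
  qed
  moreover have "P \<noteq> (\<lambda>x. {x}) ` \<Omega>"
  proof
    assume P: "P = (\<lambda>x. {x}) ` \<Omega>"
    obtain k x where k: "k \<in> K" "x \<in> \<Omega>" "k x \<noteq> x"
      using assms(1) K_one K_moves_point by blast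
    have "orb x \<in> (\<lambda>x. {x}) ` \<Omega>" using P k by (auto simp: P_def)
    then obtain z where "orb x = {z}" by auto
    hence "k x = z" "x = z" using k orb_self[of x] by (auto simp: orb_def)
    with k show False by simp
  qed
  ultimately have "P = \<B>"
    by (intro unique) (simp add: nontrivial_invariant_partition_def)
  moreover have "orb x \<in> P" using assms block_sub by (auto simp: P_def)
  ultimately have "orb x = B"
    using block_eq[of "orb x" B x] orb_self[of x] block_sub assms by blast
  with \<open>y \<in> B\<close> show ?thesis by (auto simp: orb_def)
qed

end

section \<open>Labellings of the blocks\<close>

text \<open>The indices of \<open>blk\<close> run over all naturals and count modulo
  \<open>p\<close>, so shifts along the cycle of blocks need no wrap-around.\<close>

locale cyclic_triple_system = triple_system +
  fixes a :: "'a \<Rightarrow> 'a" and p :: nat and blk :: "nat \<Rightarrow> 'a set"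
  assumes prime_p: "prime p" and odd_p: "odd p"
    and a_G: "a \<in> G" and pw_a_p: "pw a p = \<one>\<^bsub>BijGroup \<Omega>\<^esub>"
    and range_blk: "range blk = \<B>"
    and blk_eq_iff: "\<And>i j. blk i = blk j \<longleftrightarrow> [i = j] (mod p)"
    and a_blk: "\<And>i. a ` blk i = blk (Suc i)"
begin

lemma blk_in [simp]: "blk i \<in> \<B>"
  using range_blk by auto

lemma pw_a_blk: "pw a n ` blk i = blk (i + n)"
proof (induction n arbitrary: i)
  case 0
  have "\<one>\<^bsub>BijGroup \<Omega>\<^esub> ` blk i = blk i" using K_image[OF K_one blk_in] .
  then show ?case by simp
next
  case (Suc n)
  have "pw a (Suc n) ` blk i = pw a n ` (a ` blk i)"
    using a_G by (simp add: image_mult)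
  also have "\<dots> = blk (Suc i + n)" using Suc by (simp add: a_blk)
  finally show ?case by simp
qed

text \<open>Labels are chosen on \<open>blk 0\<close> and transported to the other blocks by powers
  of \<open>a\<close>; going once around is consistent because the \<open>p\<close>-th power of
  \<open>a\<close> is the identity.\<close>

lemma exists_labelling:
  "\<exists>l::'a \<Rightarrow> int. (\<forall>B\<in>\<B>. bij_betw l B {0,1,2}) \<and> (\<forall>x\<in>\<Omega>. l (a x) = l x)"
proof -
  have p0: "p > 0" using prime_p prime_gt_0_nat by blast
  have ex: "\<exists>i<p. x \<in> blk i" if "x \<in> \<Omega>" for x
  proof -
    from in_some_block[OF that] obtain i where "x \<in> blk i"
      using range_blk by auto
    moreover have "blk i = blk (i mod p)" by (simp add: blk_eq_iff cong_def)
    ultimately show ?thesis using p0 mod_less_divisor by blast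
  qed
  define idx where "idx x = (SOME i. i < p \<and> x \<in> blk i)" for x
  have idx: "idx x < p" "x \<in> blk (idx x)" if "x \<in> \<Omega>" for x
    using someI_ex[OF ex[OF that]] by (auto simp: idx_def)
  have idx_eq: "idx x = i" if "x \<in> blk i" "i < p" for x i
  proof -
    have x: "x \<in> \<Omega>" using block_sub[OF blk_in that(1)] .
    have "blk (idx x) = blk i" using block_eq[OF blk_in blk_in idx(2)[OF x] that(1)] .
    thus ?thesis using that idx[OF x] by (simp add: blk_eq_iff cong_def)
  qed
  \<comment> \<open>The exponent carries block \<open>idx x\<close> to block \<open>p\<close>, which
    is block 0 again; for \<open>idx x = 0\<close> it is \<open>p\<close>, where the power is the
    identity.\<close>
  define pull where "pull x = pw a (p - idx x) x" for x
  have pull: "bij_betw pull (blk i) (blk 0)" if "i < p" for i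
  proof -
    have "pw a (p - i) ` blk i = blk p" using that by (simp add: pw_a_blk)
    also have "\<dots> = blk 0" by (simp add: blk_eq_iff cong_def)
    finally have img: "pw a (p - i) ` blk i = blk 0" .
    have "blk i \<subseteq> \<Omega>"
      by (rule subsetI) (rule block_sub[OF blk_in])
    from bij_betw_subset[OF G_bij[OF pw_closed[OF a_G]] this img]
    have "bij_betw (pw a (p - i)) (blk i) (blk 0)" .
    moreover have eq: "pw a (p - i) x = pull x" if "x \<in> blk i" for x
      using that \<open>i < p\<close> by (simp add: pull_def idx_eq)
    ultimately show ?thesis
      using bij_betw_cong[of "blk i" "pw a (p - i)" pull "blk 0", OF eq] by simp
  qed
  have pull_a: "pull (a x) = pull x" if "x \<in> \<Omega>" for x
  proof (cases "Suc (idx x) < p")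
    case True
    have "a x \<in> blk (Suc (idx x))" using idx[OF that] a_blk by blast
    hence "idx (a x) = Suc (idx x)" using True idx_eq by blast
    moreover have "p - idx x = Suc (p - Suc (idx x))" using True by simp
    ultimately show ?thesis using that a_G by (simp add: pull_def)
  next
    case False
    \<comment> \<open>At the wrap-around the exponent is 1 for \<open>x\<close> and \<open>p\<close>
      for \<open>a x\<close>, and both sides equal \<open>a x\<close>.\<close>
    hence i: "Suc (idx x) = p" using idx[OF that] by simp
    have "a x \<in> blk p" using idx[OF that] a_blk i by blast
    hence "a x \<in> blk 0" using blk_eq_iff[of p 0] by (simp add: cong_def)
    hence "idx (a x) = 0" using idx_eq p0 by blast
    moreover have "p - idx x = Suc 0" using i by simp
    moreover have "pw a (Suc 0) = a" using G_carrier[OF a_G] by simp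
    ultimately show ?thesis using that a_G by (simp only: pull_def pw_a_p diff_zero one_app app_in)
  qed
  have "finite (blk 0)" by (rule card_ge_0_finite) (simp add: card_block)
  then obtain l0 where l0: "bij_betw l0 (blk 0) {0,1,2::int}"
    using finite_same_card_bij[of "blk 0" "{0,1,2::int}"] card_block[OF blk_in] by auto
  have "bij_betw (l0 \<circ> pull) B {0,1,2}" if "B \<in> \<B>" for B
  proof -
    from that range_blk obtain i where "B = blk i" by auto
    also have "\<dots> = blk (i mod p)" by (simp add: blk_eq_iff cong_def)
    finally show ?thesis using bij_betw_trans[OF pull l0] p0 by simp
  qed
  moreover have "(l0 \<circ> pull) (a x) = (l0 \<circ> pull) x" if "x \<in> \<Omega>" for x
    using pull_a[OF that] by simp
  ultimately show ?thesis by blast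
qed

end

section \<open>Sign and translation of the maps between blocks\<close>

locale labelled_triple_system = cyclic_triple_system +
  fixes l :: "'a \<Rightarrow> int"
  assumes l_bij: "\<And>B. B \<in> \<B> \<Longrightarrow> bij_betw l B {0,1,2}"
    and l_a: "\<And>x. x \<in> \<Omega> \<Longrightarrow> l (a x) = l x"
begin

text \<open>In labels, \<open>g\<close> acts from \<open>B\<close> to its image as an element of
  AGL(1,3). The equation is a congruence because labels are the integers 0, 1, 2, a range that
  \<open>e * l x + c\<close> may leave.\<close>

definition affine :: "('a \<Rightarrow> 'a) \<Rightarrow> 'a set \<Rightarrow> int \<Rightarrow> int \<Rightarrow> bool" where
  "affine g B e c \<longleftrightarrow> (e = 1 \<or> e = -1) \<and> (\<forall>x\<in>B. 3 dvd (l (g x) - e * l x - c))"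

text \<open>This is the parity of the permutation of labels: translations are even, reflections are
  odd.\<close>

definition eta :: "('a \<Rightarrow> 'a) \<Rightarrow> 'a set \<Rightarrow> int" where
  "eta g B = (THE e. \<exists>c. affine g B e c)"

text \<open>The translation is determined only modulo 3, so an arbitrary representative is taken and
  statements about \<open>tr\<close> are divisibilities by 3.\<close>

definition tr :: "('a \<Rightarrow> 'a) \<Rightarrow> 'a set \<Rightarrow> int" where
  "tr g B = (SOME c. affine g B (eta g B) c)"

lemma l_range: "B \<in> \<B> \<Longrightarrow> x \<in> B \<Longrightarrow> l x = 0 \<or> l x = 1 \<or> l x = 2"
  using bij_betwE[OF l_bij] by blast

lemma l_inj: "B \<in> \<B> \<Longrightarrow> x \<in> B \<Longrightarrow> y \<in> B \<Longrightarrow> l x = l y \<Longrightarrow> x = y"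
  using bij_betw_imp_inj_on[OF l_bij] inj_onD by metis

lemma l_points:
  assumes "B \<in> \<B>"
  obtains x0 x1 x2 where "B = {x0, x1, x2}" "l x0 = 0" "l x1 = 1" "l x2 = 2"
proof -
  have "l ` B = {0,1,2}" by (rule bij_betw_imp_surj_on[OF l_bij[OF assms]])
  hence "0 \<in> l ` B" "1 \<in> l ` B" "2 \<in> l ` B" by simp_all
  then obtain x0 x1 x2 where x: "x0 \<in> B" "x1 \<in> B" "x2 \<in> B" "l x0 = 0" "l x1 = 1" "l x2 = 2"
    unfolding image_iff by metis
  have "B \<subseteq> {x0, x1, x2}"
  proof
    fix y assume y: "y \<in> B"
    have "l y = l x0 \<or> l y = l x1 \<or> l y = l x2" using l_range[OF assms y] x(4-6) by simp
    hence "y = x0 \<or> y = x1 \<or> y = x2" using l_inj[OF assms y] x(1-3) by blast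
    thus "y \<in> {x0, x1, x2}" by simp
  qed
  with x have "B = {x0, x1, x2}" by blast
  from that[OF this x(4-6)] show thesis .
qed

text \<open>AGL(1,3) is all of Sym(3), so each of the six bijections of labels is affine; the
  constant is the image of the label 0.\<close>

lemma affine_exists:
  assumes "g \<in> G" "B \<in> \<B>"
  shows "\<exists>e c. affine g B e c"
proof -
  obtain x0 x1 x2 where x: "B = {x0, x1, x2}" "l x0 = 0" "l x1 = 1" "l x2 = 2"
    using l_points[OF assms(2)] .
  have ne: "l (g u) \<noteq> l (g v)" if "u \<in> B" "v \<in> B" "u \<noteq> v" for u v
  proof
    assume "l (g u) = l (g v)"
    hence "g u = g v" using l_inj[OF image_block[OF assms]] that by blast
    thus False using app_inj[OF assms(1)] block_sub[OF assms(2)] that by blast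
  qed
  have r: "l (g u) = 0 \<or> l (g u) = 1 \<or> l (g u) = 2" if "u \<in> B" for u
    using l_range[OF image_block[OF assms]] that by blast
  have mem: "x0 \<in> B" "x1 \<in> B" "x2 \<in> B" by (simp_all add: x(1))
  have "x0 \<noteq> x1" "x0 \<noteq> x2" "x1 \<noteq> x2" using x(2-4) by auto
  hence "l (g x0) \<noteq> l (g x1)" "l (g x0) \<noteq> l (g x2)" "l (g x1) \<noteq> l (g x2)"
    using ne mem by blast+
  moreover have "l (g x0) = 0 \<or> l (g x0) = 1 \<or> l (g x0) = 2"
    "l (g x1) = 0 \<or> l (g x1) = 1 \<or> l (g x1) = 2"
    "l (g x2) = 0 \<or> l (g x2) = 1 \<or> l (g x2) = 2"
    using r mem by blast+
  ultimately have "affine g B 1 (l (g x0)) \<or> affine g B (-1) (l (g x0))"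
    unfolding affine_def using x by auto
  thus ?thesis by blast
qed

text \<open>The label 0 determines the constant modulo 3, and then the label 1 determines the
  multiplier because 1 and -1 differ modulo 3.\<close>

lemma affine_unique:
  assumes "B \<in> \<B>" "affine g B e c" "affine g B e' c'"
  shows "e = e' \<and> 3 dvd (c - c')"
proof -
  obtain x0 x1 x2 where x: "B = {x0, x1, x2}" "l x0 = 0" "l x1 = 1" "l x2 = 2"
    using l_points[OF assms(1)] .
  have e: "e = 1 \<or> e = -1" "e' = 1 \<or> e' = -1" using assms by (auto simp: affine_def)
  have "3 dvd (l (g x0) - c)" "3 dvd (l (g x0) - c')"
    "3 dvd (l (g x1) - e - c)" "3 dvd (l (g x1) - e' - c')"
    using assms(2,3) x by (auto simp: affine_def)
  moreover from this(1,2) have "3 dvd (c - c')" by presburger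
  ultimately show ?thesis using e by (elim disjE; simp; presburger)
qed

lemma affine_eta_tr:
  assumes "g \<in> G" "B \<in> \<B>"
  shows "affine g B (eta g B) (tr g B)"
proof -
  obtain e c where ec: "affine g B e c" using affine_exists[OF assms] by blast
  have "eta g B = e"
    unfolding eta_def using ec affine_unique[OF assms(2)] by (intro the_equality) blast+
  thus ?thesis unfolding tr_def using ec by (metis someI)
qed

lemma eta_tr_unique:
  assumes "g \<in> G" "B \<in> \<B>" "affine g B e c"
  shows "eta g B = e" "3 dvd (tr g B - c)"
  using affine_unique[OF assms(2) affine_eta_tr[OF assms(1,2)] assms(3)] by auto

lemma eta_cases: "g \<in> G \<Longrightarrow> B \<in> \<B> \<Longrightarrow> eta g B = 1 \<or> eta g B = -1"
  using affine_eta_tr by (simp add: affine_def)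

text \<open>Composition of affine maps, with the data of \<open>g\<close> taken on the image of
  \<open>B\<close> under \<open>h\<close>, where \<open>g\<close> is applied.\<close>

lemma affine_mult:
  assumes "g \<in> G" "h \<in> G" "B \<in> \<B>"
  shows "affine (g \<cdot> h) B (eta g (h ` B) * eta h B) (eta g (h ` B) * tr h B + tr g (h ` B))"
proof -
  let ?e = "eta g (h ` B)"
  have e: "?e = 1 \<or> ?e = -1" "eta h B = 1 \<or> eta h B = -1"
    using assms eta_cases image_block by auto
  have "3 dvd (l ((g \<cdot> h) x) - ?e * eta h B * l x - (?e * tr h B + tr g (h ` B)))" if "x \<in> B" for x
  proof -
    have "3 dvd (l (h x) - eta h B * l x - tr h B)"
      using affine_eta_tr[OF assms(2,3)] that by (simp add: affine_def)
    hence "3 dvd ?e * (l (h x) - eta h B * l x - tr h B)" by simp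
    moreover have "3 dvd (l (g (h x)) - ?e * l (h x) - tr g (h ` B))"
      using affine_eta_tr[OF assms(1) image_block[OF assms(2,3)]] that by (simp add: affine_def)
    ultimately have "3 dvd ?e * (l (h x) - eta h B * l x - tr h B) + (l (g (h x)) - ?e * l (h x) - tr g (h ` B))"
      by (rule dvd_add)
    thus ?thesis using that assms block_sub by (simp add: algebra_simps)
  qed
  thus ?thesis using e by (auto simp: affine_def)
qed

lemma eta_mult:
  "g \<in> G \<Longrightarrow> h \<in> G \<Longrightarrow> B \<in> \<B> \<Longrightarrow> eta (g \<cdot> h) B = eta g (h ` B) * eta h B"
  using eta_tr_unique(1) affine_mult mult_closed by blast

lemma tr_mult:
  "g \<in> G \<Longrightarrow> h \<in> G \<Longrightarrow> B \<in> \<B> \<Longrightarrow>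
     3 dvd (tr (g \<cdot> h) B - (eta g (h ` B) * tr h B + tr g (h ` B)))"
  using eta_tr_unique(2) affine_mult mult_closed by blast

lemma affine_one: "B \<in> \<B> \<Longrightarrow> affine \<one>\<^bsub>BijGroup \<Omega>\<^esub> B 1 0"
  using block_sub by (auto simp: affine_def)

lemma eta_one: "B \<in> \<B> \<Longrightarrow> eta \<one>\<^bsub>BijGroup \<Omega>\<^esub> B = 1"
  using eta_tr_unique(1)[OF one_closed _ affine_one] by simp

lemma tr_one: "B \<in> \<B> \<Longrightarrow> 3 dvd tr \<one>\<^bsub>BijGroup \<Omega>\<^esub> B"
  using eta_tr_unique(2)[OF one_closed _ affine_one] by simp

lemma eta_iv: "g \<in> G \<Longrightarrow> B \<in> \<B> \<Longrightarrow> eta (iv g) (g ` B) = eta g B"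
  using eta_mult[of "iv g" g B] eta_one[of B] eta_cases[of g B] G_carrier[of g]
  by (auto simp: Sym.l_inv)

lemma eta_a: "B \<in> \<B> \<Longrightarrow> eta a B = 1"
  using block_sub l_a by (intro eta_tr_unique(1)[where c = 0] a_G) (auto simp: affine_def)

lemma eta_pw_a: "B \<in> \<B> \<Longrightarrow> eta (pw a n) B = 1"
  by (induction n arbitrary: B) (simp_all add: eta_one eta_mult a_G eta_a image_block)

lemma tr_fixed_point:
  assumes "g \<in> G" "B \<in> \<B>" "eta g B = 1" "x \<in> B" "g x = x"
  shows "3 dvd tr g B"
proof -
  have "3 dvd (l (g x) - l x - tr g B)"
    using affine_eta_tr[OF assms(1,2)] assms(3,4) by (simp add: affine_def)
  thus ?thesis using assms by simp
qed

text \<open>Labels in \<open>{0,1,2}\<close> that are congruent modulo 3 are equal. Together with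
  \<open>tr_fixed_point\<close>, an even map of a block to itself that fixes one point fixes all
  three.\<close>

lemma fixed_pointwise:
  assumes "g \<in> G" "B \<in> \<B>" "g ` B = B" "eta g B = 1" "3 dvd tr g B" "x \<in> B"
  shows "g x = x"
proof -
  have "3 dvd (l (g x) - l x - tr g B)"
    using affine_eta_tr[OF assms(1,2)] assms(4,6) by (simp add: affine_def)
  hence "3 dvd (l (g x) - l x)" using assms(5) by presburger
  moreover have "g x \<in> B" using assms by blast
  ultimately have "l (g x) = l x"
    using l_range[OF assms(2) \<open>g x \<in> B\<close>] l_range[OF assms(2,6)] by auto
  thus ?thesis using l_inj assms \<open>g x \<in> B\<close> by blast
qed

end

section \<open>The sign is independent of the block\<close>

text \<open>\<open>a_normal\<close> is the normality of the group generated by \<alpha> in the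
  induced group, lifted to \<open>G\<close>: a conjugate of \<open>a\<close> is a power of
  \<open>a\<close> up to an element of \<open>K\<close>.\<close>

locale labelled_kernel_system = labelled_triple_system +
  assumes K_no_derangement: "\<And>k. k \<in> K \<Longrightarrow> \<exists>x\<in>\<Omega>. k x = x"
    and K_transitive: "\<And>B x y. B \<in> \<B> \<Longrightarrow> x \<in> B \<Longrightarrow> y \<in> B \<Longrightarrow> \<exists>k\<in>K. k x = y"
    and K_involution: "\<exists>k\<in>K. k \<noteq> \<one>\<^bsub>BijGroup \<Omega>\<^esub> \<and> k \<cdot> k = \<one>\<^bsub>BijGroup \<Omega>\<^esub>"
    and a_normal: "\<And>g. g \<in> G \<Longrightarrow> \<exists>n. \<exists>k\<in>K. g \<cdot> a = pw a n \<cdot> k \<cdot> g"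
begin

text \<open>The part of \<open>K\<close> that acts on each block as a translation of labels, hence
  trivially or as a 3-cycle.\<close>

definition E :: "('a \<Rightarrow> 'a) set" where
  "E = {k \<in> K. \<forall>B\<in>\<B>. eta k B = 1}"

lemma E_K: "c \<in> E \<Longrightarrow> c \<in> K" and E_eta: "c \<in> E \<Longrightarrow> B \<in> \<B> \<Longrightarrow> eta c B = 1"
  by (simp_all add: E_def)

lemma eta_mult_K: "g \<in> K \<Longrightarrow> h \<in> K \<Longrightarrow> B \<in> \<B> \<Longrightarrow> eta (g \<cdot> h) B = eta g B * eta h B"
  by (simp add: eta_mult K_G K_image)

lemma eta_iv_K: "g \<in> K \<Longrightarrow> B \<in> \<B> \<Longrightarrow> eta (iv g) B = eta g B"
  using eta_iv[of g B] by (simp add: K_G K_image)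

lemma tr_mult_K: "g \<in> K \<Longrightarrow> h \<in> K \<Longrightarrow> B \<in> \<B> \<Longrightarrow>
    3 dvd (tr (g \<cdot> h) B - (eta g B * tr h B + tr g B))"
  using tr_mult[of g h B] by (simp add: K_G K_image)

lemma E_mult [simp]: "c \<in> E \<Longrightarrow> d \<in> E \<Longrightarrow> c \<cdot> d \<in> E"
  by (simp add: E_def eta_mult_K)

lemma E_one [simp]: "\<one>\<^bsub>BijGroup \<Omega>\<^esub> \<in> E"
  by (simp add: E_def eta_one)

lemma tr_mult_E: "c \<in> E \<Longrightarrow> d \<in> E \<Longrightarrow> B \<in> \<B> \<Longrightarrow> 3 dvd (tr (c \<cdot> d) B - (tr c B + tr d B))"
  using tr_mult_K[of c d B] by (simp add: E_K E_eta add.commute)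

text \<open>Conjugating x + c by x -> e x + f gives x + e c, so conjugation by \<open>k\<close>
  multiplies the translation on each block by the sign of \<open>k\<close> there.\<close>

lemma E_conj:
  assumes "c \<in> E" "k \<in> K"
  shows "k \<cdot> c \<cdot> iv k \<in> E" and "B \<in> \<B> \<Longrightarrow> 3 dvd (tr (k \<cdot> c \<cdot> iv k) B - eta k B * tr c B)"
proof -
  have cK: "c \<in> K" using assms E_K by blast
  have eta: "eta k B * eta k B = 1" if "B \<in> \<B>" for B
    using eta_cases[OF K_G[OF assms(2)] that] by auto
  show "k \<cdot> c \<cdot> iv k \<in> E"
    using assms cK eta by (simp add: E_def eta_mult_K eta_iv_K)
  assume B: "B \<in> \<B>"
  have 1: "3 dvd (tr (k \<cdot> c \<cdot> iv k) B - (eta (k \<cdot> c) B * tr (iv k) B + tr (k \<cdot> c) B))"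
    using tr_mult_K[of "k \<cdot> c" "iv k" B] assms cK B by simp
  have 2: "3 dvd (tr (k \<cdot> c) B - (eta k B * tr c B + tr k B))"
    using tr_mult_K[of k c B] assms cK B by simp
  have 3: "3 dvd (tr (k \<cdot> iv k) B - (eta k B * tr (iv k) B + tr k B))"
    using tr_mult_K[of k "iv k" B] assms B by simp
  have 4: "3 dvd tr (k \<cdot> iv k) B"
    using tr_one[OF B] assms(2) G_carrier[OF K_G] by simp
  have 5: "eta (k \<cdot> c) B = eta k B" using assms cK B by (simp add: eta_mult_K E_eta)
  \<comment> \<open>With the products of signs and translations taken as unknowns, the claim is
    linear modulo 3.\<close>
  define u v w x y z where "u = tr (k \<cdot> c \<cdot> iv k) B" and "v = eta k B * tr (iv k) B"
    and "w = tr (k \<cdot> c) B" and "x = eta k B * tr c B" and "y = tr k B" and "z = tr (k \<cdot> iv k) B"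
  have "3 dvd (u - (v + w))" "3 dvd (w - (x + y))" "3 dvd (z - (v + y))" "3 dvd z"
    using 1 2 3 4 5 by (simp_all add: u_def v_def w_def x_def y_def z_def)
  hence "3 dvd (u - x)" by presburger
  thus "3 dvd (tr (k \<cdot> c \<cdot> iv k) B - eta k B * tr c B)" by (simp add: u_def x_def)
qed

text \<open>
  \<open>K\<close> acts on \<open>B\<close> as a transitive group, so some element acts as a 3-cycle on \<open>B\<close>; its square still
  does, and is even on every block.
\<close>

lemma exists_E_three_cycle:
  assumes B: "B \<in> \<B>"
  shows "\<exists>c\<in>E. \<not> 3 dvd tr c B"
proof -
  obtain x0 x1 x2 where x: "B = {x0, x1, x2}" "l x0 = 0" "l x1 = 1" "l x2 = 2"
    using l_points[OF B] .
  obtain k1 k2 where k: "k1 \<in> K" "k2 \<in> K" "k1 x0 = x1" "k2 x0 = x2"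
    using K_transitive[OF B, of x0 x1] K_transitive[OF B, of x0 x2] x by auto
  have aff: "affine k1 B (eta k1 B) (tr k1 B)" "affine k2 B (eta k2 B) (tr k2 B)"
    using affine_eta_tr k B by (auto simp: K_G)
  have t: "3 dvd (1 - tr k1 B)" "3 dvd (2 - tr k2 B)"
    using aff x k by (auto simp: affine_def)
  have "\<exists>k\<in>K. eta k B = 1 \<and> \<not> 3 dvd tr k B"
  proof (cases "eta k1 B = 1 \<or> eta k2 B = 1")
    case True
    have "\<not> 3 dvd tr k1 B" "\<not> 3 dvd tr k2 B" using t by presburger+
    with True k show ?thesis by blast
  next
    case False
    hence e: "eta k1 B = -1" "eta k2 B = -1"
      using eta_cases[OF K_G[OF k(1)] B] eta_cases[OF K_G[OF k(2)] B] by auto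
    \<comment> \<open>Two reflections with constants 1 and 2 compose to the translation by -1, which
      is not 0 modulo 3.\<close>
    have "3 dvd (tr (k1 \<cdot> k2) B - (- tr k2 B + tr k1 B))"
      using tr_mult_K[OF k(1,2) B] e by simp
    hence "\<not> 3 dvd tr (k1 \<cdot> k2) B" using t by presburger
    moreover have "eta (k1 \<cdot> k2) B = 1" using e k B by (simp add: eta_mult_K)
    ultimately show ?thesis using k by (intro bexI[of _ "k1 \<cdot> k2"]) auto
  qed
  then obtain k where k: "k \<in> K" "eta k B = 1" "\<not> 3 dvd tr k B" by blast
  have "eta k B' * eta k B' = 1" if "B' \<in> \<B>" for B'
    using eta_cases[OF K_G[OF k(1)] that] by auto
  hence "k \<cdot> k \<in> E" using k by (simp add: E_def eta_mult_K)
  moreover have "\<not> 3 dvd tr (k \<cdot> k) B"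
    using tr_mult_K[OF k(1) k(1) B] k(2,3) by simp presburger
  ultimately show ?thesis by blast
qed

text \<open>That all of \<open>K\<close> has equal signs on two blocks is an equivalence relation
  between indices that is invariant under shifts. If it joined two distinct blocks, their index
  difference, invertible modulo the prime \<open>p\<close>, would by repeated shifts join all
  blocks, contrary to the given \<open>k\<close>.\<close>

lemma separated_blocks:
  assumes k: "k \<in> K" "B \<in> \<B>" "B' \<in> \<B>" "eta k B \<noteq> eta k B'"
    and C: "C \<in> \<B>" "C' \<in> \<B>" "C \<noteq> C'"
  shows "\<exists>k\<in>K. eta k C \<noteq> eta k C'"
proof (rule ccontr)
  assume contra: "\<not> ?thesis"
  define same where "same i j \<longleftrightarrow> (\<forall>k\<in>K. eta k (blk i) = eta k (blk j))" for i j
  have shift: "same (i + m) (j + m)" if "same i j" for i j m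
    unfolding same_def
  proof
    fix k assume k: "k \<in> K"
    let ?g = "pw a m"
    have g: "?g \<in> G" using a_G by simp
    \<comment> \<open>Conjugation by a power of \<open>a\<close> shifts the signs of
      \<open>k\<close> by \<open>m\<close> blocks, as powers of \<open>a\<close> have sign
      1.\<close>
    define h where "h = iv ?g \<cdot> k \<cdot> ?g"
    have h: "h \<in> K" using K_conj[of "iv ?g" k] k g G_carrier[OF g] by (simp add: h_def)
    have "eta h (blk n) = eta k (blk (n + m))" for n
    proof -
      have "?g \<cdot> h = k \<cdot> ?g"
        using k g by (intro G_eqI) (auto simp: h_def K_G)
      moreover have "eta (?g \<cdot> h) (blk n) = eta h (blk n)"
        using eta_mult[of ?g h "blk n"] g h by (simp add: K_G K_image eta_pw_a)
      moreover have "eta (k \<cdot> ?g) (blk n) = eta k (blk (n + m))"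
        using eta_mult[of k ?g "blk n"] g k by (simp add: K_G eta_pw_a pw_a_blk)
      ultimately show ?thesis by simp
    qed
    moreover have "eta h (blk i) = eta h (blk j)" using that h by (simp add: same_def)
    ultimately show "eta k (blk (i + m)) = eta k (blk (j + m))" by simp
  qed
  have p0: "p > 0" using prime_p prime_gt_0_nat by blast
  obtain i j0 where ij: "C = blk i" "C' = blk j0" using C range_blk by auto
  \<comment> \<open>The index difference \<open>j0 - i\<close> modulo \<open>p\<close>; adding
    \<open>p * i\<close> keeps the subtraction from being truncated.\<close>
  define m where "m = j0 + p * i - i"
  have "i \<le> p * i" using mult_le_mono1[of 1 p i] p0 by simp
  hence im: "i + m = j0 + p * i" unfolding m_def by linarith
  have "blk (i + m) = C'" using ij im by (simp add: blk_eq_iff cong_def)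
  hence same: "same i (i + m)" and "\<not> [i + m = i] (mod p)"
    using contra C ij by (auto simp: same_def simp flip: blk_eq_iff)
  hence "\<not> p dvd m"
    using cong_add_lcancel_0_nat cong_0_iff by blast
  hence "coprime m p" using prime_p by (metis coprime_commute prime_imp_coprime)
  then obtain x where x: "[m * x = 1] (mod p)" using cong_solve_coprime_nat by auto
  have mult: "same i (i + m * n)" for n
  proof (induction n)
    case 0 show ?case by (simp add: same_def)
  next
    case (Suc n)
    have "same (i + m * n) (i + m + m * n)" using shift[OF same] .
    with Suc show ?case by (simp add: same_def ac_simps)
  qed
  have all: "eta k (blk i) = eta k D" if "D \<in> \<B>" "k \<in> K" for D k
  proof -
    from that range_blk obtain j where j: "D = blk j" by auto
    \<comment> \<open>\<open>x\<close> inverts \<open>m\<close> modulo \<open>p\<close> and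
      \<open>(p - 1) * i\<close> stands for \<open>- i\<close>, so \<open>i + m * n\<close> is
      congruent to \<open>j\<close>.\<close>
    define n where "n = x * (j + (p - 1) * i)"
    have "[i + (m * x) * (j + (p - 1) * i) = i + 1 * (j + (p - 1) * i)] (mod p)"
      using x by (intro cong_add cong_mult cong_refl)
    also have "i + 1 * (j + (p - 1) * i) = j + p * i"
      using p0 by (cases p) auto
    also have "[j + p * i = j] (mod p)" by (simp add: cong_def)
    finally have "[i + m * n = j] (mod p)" by (simp add: n_def mult.assoc)
    hence "blk (i + m * n) = D" using j by (simp add: blk_eq_iff)
    thus ?thesis using mult[of n] that by (simp add: same_def)
  qed
  show False using all k by metis
qed

text \<open>If some \<open>k\<close> had two signs, any two blocks could be separated. Multiplying a
  3-cycle by its conjugates then cancels it on chosen blocks and gives elements of \<open>K\<close>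
  supported on one block; a product of these moves every point.\<close>

lemma eta_const_on_K:
  assumes "k \<in> K" "B \<in> \<B>" "B' \<in> \<B>"
  shows "eta k B = eta k B'"
proof (rule ccontr)
  assume "eta k B \<noteq> eta k B'"
  note sep = separated_blocks[OF assms this]
  \<comment> \<open>The blocks of \<open>T\<close> are cleared one at a time while the translation
    on \<open>B\<close> stays non-trivial.\<close>
  have isolate: "\<exists>c\<in>E. \<not> 3 dvd tr c B \<and> (\<forall>C\<in>T. 3 dvd tr c C)"
    if "finite T" "T \<subseteq> \<B> - {B}" "B \<in> \<B>" for T B
    using that
  proof (induction T rule: finite_induct)
    case empty
    then show ?case using exists_E_three_cycle by simp
  next
    case (insert C T)
    then obtain c where c: "c \<in> E" "\<not> 3 dvd tr c B" "\<And>C. C \<in> T \<Longrightarrow> 3 dvd tr c C" by auto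
    have C: "C \<in> \<B>" "C \<noteq> B" using insert by auto
    obtain k where k: "k \<in> K" "eta k B \<noteq> eta k C" using sep[OF insert.prems(2) C(1)] C(2) by auto
    define c' where "c' = k \<cdot> c \<cdot> iv k"
    have c': "c' \<in> E" "\<And>D. D \<in> \<B> \<Longrightarrow> 3 dvd (tr c' D - eta k D * tr c D)"
      using E_conj[OF c(1) k(1)] by (auto simp: c'_def)
    have ek: "eta k B = 1 \<or> eta k B = -1" "eta k C = 1 \<or> eta k C = -1"
      using eta_cases k insert.prems C by (auto simp: K_G)
    have T: "3 dvd tr c' D" if "D \<in> T" for D
    proof -
      have "D \<in> \<B>" using that insert.prems by auto
      moreover have "3 dvd eta k D * tr c D" using c(3)[OF that] by simp
      ultimately show ?thesis using c'(2) by (metis dvd_diffD zdvd_zdiffD)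
    qed
    consider "eta k B = 1" "eta k C = -1" | "eta k B = -1" "eta k C = 1" using ek k by auto
    then show ?case
    proof cases
      case 1
      \<comment> \<open>Here \<open>c'\<close> has the translation of \<open>c\<close> on
        \<open>B\<close> and its negative on \<open>C\<close>, so the product doubles it on
        \<open>B\<close> and cancels it on \<open>C\<close>.\<close>
      have d: "3 dvd (tr (c' \<cdot> c) D - (tr c' D + tr c D))" if "D \<in> \<B>" for D
        using tr_mult_E[OF c'(1) c(1) that] .
      have "\<not> 3 dvd tr (c' \<cdot> c) B"
        using d[OF insert.prems(2)] c'(2)[OF insert.prems(2)] 1 c(2) by simp presburger
      moreover have "3 dvd tr (c' \<cdot> c) C"
        using d[OF C(1)] c'(2)[OF C(1)] 1 by simp presburger
      moreover have "3 dvd tr (c' \<cdot> c) D" if "D \<in> T" for D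
      proof -
        have "D \<in> \<B>" using that insert.prems by auto
        from d[OF this] T[OF that] c(3)[OF that] show ?thesis by presburger
      qed
      ultimately show ?thesis using E_mult[OF c'(1) c(1)] by blast
    next
      case 2
      \<comment> \<open>With the signs exchanged, a translation t of \<open>c\<close> becomes -t + 2
        t = t on \<open>B\<close> and t + 2 t = 3 t, that is 0, on \<open>C\<close>.\<close>
      have d: "3 dvd (tr (c' \<cdot> (c \<cdot> c)) D - (tr c' D + 2 * tr c D))" if "D \<in> \<B>" for D
      proof -
        have "3 dvd (tr (c' \<cdot> (c \<cdot> c)) D - (tr c' D + tr (c \<cdot> c) D))"
             "3 dvd (tr (c \<cdot> c) D - (tr c D + tr c D))"
          by (rule tr_mult_E; use that c c' in simp)+
        thus ?thesis by presburger
      qed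
      have "\<not> 3 dvd tr (c' \<cdot> (c \<cdot> c)) B"
        using d[OF insert.prems(2)] c'(2)[OF insert.prems(2)] 2 c(2) by simp presburger
      moreover have "3 dvd tr (c' \<cdot> (c \<cdot> c)) C"
        using d[OF C(1)] c'(2)[OF C(1)] 2 by simp presburger
      moreover have "3 dvd tr (c' \<cdot> (c \<cdot> c)) D" if "D \<in> T" for D
      proof -
        have "D \<in> \<B>" using that insert.prems by auto
        from d[OF this] T[OF that] c(3)[OF that] show ?thesis by presburger
      qed
      ultimately show ?thesis using E_mult[OF c'(1) E_mult[OF c(1) c(1)]] by blast
    qed
  qed
  \<comment> \<open>\<open>T\<close> collects the blocks with non-trivial translation. Multiplying
    by isolated elements lets it grow to all of \<open>\<B>\<close>, where no point is
    fixed.\<close>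
  have "\<exists>c\<in>E. (\<forall>C\<in>T. \<not> 3 dvd tr c C) \<and> (\<forall>C\<in>\<B> - T. 3 dvd tr c C)"
    if "finite T" "T \<subseteq> \<B>" for T
    using that
  proof (induction T rule: finite_induct)
    case empty
    then show ?case by (intro bexI[of _ "\<one>\<^bsub>BijGroup \<Omega>\<^esub>"]) (auto simp: tr_one)
  next
    case (insert C T)
    then obtain c where c: "c \<in> E" "\<And>D. D \<in> T \<Longrightarrow> \<not> 3 dvd tr c D"
      "\<And>D. D \<in> \<B> \<Longrightarrow> D \<notin> T \<Longrightarrow> 3 dvd tr c D" by auto
    obtain c' where c': "c' \<in> E" "\<not> 3 dvd tr c' C" "\<And>D. D \<in> \<B> \<Longrightarrow> D \<noteq> C \<Longrightarrow> 3 dvd tr c' D"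
      using isolate[of "\<B> - {C}" C] finite_blocks insert.prems by auto
    have d: "3 dvd (tr (c' \<cdot> c) D - (tr c' D + tr c D))" if "D \<in> \<B>" for D
      using tr_mult_E[OF c'(1) c(1) that] .
    have 1: "\<not> 3 dvd tr (c' \<cdot> c) C"
      using d[of C] c(3)[of C] c'(2) insert by simp presburger
    have 2: "\<not> 3 dvd tr (c' \<cdot> c) D" if "D \<in> T" for D
    proof -
      have "D \<in> \<B>" "D \<noteq> C" using that insert by auto
      thus ?thesis using d[OF \<open>D \<in> \<B>\<close>] c(2)[OF that] c'(3)[OF \<open>D \<in> \<B>\<close> \<open>D \<noteq> C\<close>] by presburger
    qed
    have 3: "3 dvd tr (c' \<cdot> c) D" if "D \<in> \<B>" "D \<notin> insert C T" for D
      using d[of D] c(3)[of D] c'(3)[of D] that by simp presburger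
    from 1 2 3 show ?case using E_mult[OF c'(1) c(1)] by blast
  qed
  from this[OF finite_blocks] obtain c where c: "c \<in> E" "\<And>C. C \<in> \<B> \<Longrightarrow> \<not> 3 dvd tr c C" by auto
  obtain x where x: "x \<in> \<Omega>" "c x = x" using K_no_derangement[OF E_K[OF c(1)]] by blast
  obtain C where C: "C \<in> \<B>" "x \<in> C" using in_some_block[OF x(1)] by blast
  have "3 dvd tr c C" using tr_fixed_point[OF K_G[OF E_K] C(1)] c(1) C x E_eta by blast
  thus False using c(2) C by blast
qed

text \<open>Comparing signs in \<open>g \<cdot> a = pw a n \<cdot> k \<cdot> g\<close>, the sign of
  \<open>g\<close> changes by the constant factor \<open>e\<close> from each block to the next.
  After \<open>p\<close> steps the first block returns, so \<open>e ^ p = 1\<close>, and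
  \<open>e = 1\<close> as \<open>p\<close> is odd.\<close>

lemma eta_const:
  assumes "g \<in> G" "B \<in> \<B>"
  shows "eta g B = eta g (blk 0)"
proof -
  obtain n k where k: "k \<in> K" "g \<cdot> a = pw a n \<cdot> k \<cdot> g" using a_normal[OF assms(1)] by blast
  define e where "e = eta k (blk 0)"
  have step: "eta g (blk (Suc i)) = e * eta g (blk i)" for i
  proof -
    have "eta (g \<cdot> a) (blk i) = eta g (blk (Suc i))"
      using assms a_G by (simp add: eta_mult eta_a a_blk)
    moreover have "eta (pw a n \<cdot> k \<cdot> g) (blk i) = eta k (g ` blk i) * eta g (blk i)"
      using assms a_G k by (simp add: eta_mult eta_pw_a image_block K_G)
    moreover have "eta k (g ` blk i) = e"
      unfolding e_def using eta_const_on_K[OF k(1)] image_block[OF assms(1)] by simp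
    ultimately show ?thesis using k(2) by simp
  qed
  have pow: "eta g (blk i) = e ^ i * eta g (blk 0)" for i
    by (induction i) (simp_all add: step)
  have e: "e = 1 \<or> e = -1" using eta_cases k by (simp add: e_def K_G)
  have "blk p = blk 0" by (simp add: blk_eq_iff cong_def)
  with pow[of p] eta_cases[OF assms(1) blk_in, of 0] have "e ^ p = 1" by auto
  with e odd_p have "e = 1" by auto
  moreover obtain i where "B = blk i" using assms range_blk by auto
  ultimately show ?thesis using pow[of i] by simp
qed

end

section \<open>Intersecting families\<close>

context labelled_kernel_system
begin

text \<open>By \<open>eta_const\<close> the choice of block does not matter, which makes
  \<open>eps\<close> a homomorphism from \<open>G\<close> to \<open>{1,-1}\<close>.\<close>

definition eps :: "('a \<Rightarrow> 'a) \<Rightarrow> int" where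
  "eps g = eta g (blk 0)"

lemma eps_cases: "g \<in> G \<Longrightarrow> eps g = 1 \<or> eps g = -1"
  using eta_cases by (simp add: eps_def)

lemma eps_mult: "g \<in> G \<Longrightarrow> h \<in> G \<Longrightarrow> eps (g \<cdot> h) = eps g * eps h"
  using eta_mult[of g h "blk 0"] eta_const[of g "h ` blk 0"] by (simp add: eps_def image_block)

lemma eps_iv: "g \<in> G \<Longrightarrow> eps (iv g) = eps g"
  using eta_iv[of g "blk 0"] eta_const[of "iv g" "g ` blk 0"] by (simp add: eps_def image_block)

lemma E_iff: "c \<in> E \<longleftrightarrow> c \<in> K \<and> eps c = 1"
proof
  assume "c \<in> E"
  thus "c \<in> K \<and> eps c = 1" using E_K E_eta[OF _ blk_in] by (simp add: eps_def)
next
  assume c: "c \<in> K \<and> eps c = 1"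
  hence "eta c B = 1" if "B \<in> \<B>" for B
    using eta_const[OF K_G that] by (simp add: eps_def)
  with c show "c \<in> E" by (simp add: E_def)
qed

lemma eps_quotient: "g \<in> G \<Longrightarrow> h \<in> G \<Longrightarrow> eps g = eps h \<Longrightarrow> eps (g \<cdot> iv h) = 1"
  using eps_mult[of g "iv h"] eps_iv[of h] eps_cases[of h] by auto

lemma finite_K: "finite K"
  using finite_subset[OF _ finite_G] K_G by blast

lemma finite_E: "finite E"
  using finite_subset[OF _ finite_K] E_K by blast

lemma left_mult_inj:
  assumes "g \<in> G" "A \<subseteq> G"
  shows "inj_on (\<lambda>h. g \<cdot> h) A"
proof (rule inj_on_inverseI)
  fix h assume "h \<in> A"
  hence "h \<in> G" using assms by blast
  thus "iv g \<cdot> (g \<cdot> h) = h" using assms by (intro G_eqI) auto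
qed

lemma right_mult_inj:
  assumes "g \<in> G" "A \<subseteq> G"
  shows "inj_on (\<lambda>h. h \<cdot> g) A"
proof (rule inj_on_inverseI)
  fix h assume "h \<in> A"
  hence "h \<in> G" using assms by blast
  thus "(h \<cdot> g) \<cdot> iv g = h" using assms by (intro G_eqI) auto
qed

text \<open>An involution is odd: on a block where it moves a point, sign 1 would give a translation
  c with 2 c = 0 modulo 3, hence the identity there. So \<open>E\<close> and its coset by the
  involution are disjoint in \<open>K\<close>.\<close>

lemma two_card_E: "2 * card E \<le> card K"
proof -
  obtain k where k: "k \<in> K" "k \<noteq> \<one>\<^bsub>BijGroup \<Omega>\<^esub>" "k \<cdot> k = \<one>\<^bsub>BijGroup \<Omega>\<^esub>"
    using K_involution by blast
  obtain x where x: "x \<in> \<Omega>" "k x \<noteq> x" using K_moves_point[OF k(1,2)] by blast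
  obtain B where B: "B \<in> \<B>" "x \<in> B" using in_some_block[OF x(1)] by blast
  have "eta k B \<noteq> 1"
  proof
    assume e: "eta k B = 1"
    have "3 dvd tr k B"
      using tr_mult_K[OF k(1) k(1) B(1)] tr_one[OF B(1)] k(3) e by simp presburger
    hence "k x = x" using fixed_pointwise[OF K_G[OF k(1)] B(1) _ e _ B(2)] K_image[OF k(1) B(1)] by simp
    with x show False by simp
  qed
  hence e: "eps k = -1"
    using eta_const[OF K_G[OF k(1)] B(1)] eps_cases[OF K_G[OF k(1)]] by (simp add: eps_def)
  let ?f = "\<lambda>h. k \<cdot> h"
  have "E \<inter> ?f ` E = {}"
    using e by (auto simp: E_iff eps_mult K_G k)
  hence "card (E \<union> ?f ` E) = card E + card (?f ` E)"
    using finite_E by (simp add: card_Un_disjoint)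
  also have "card (?f ` E) = card E"
    using left_mult_inj[OF K_G[OF k(1)], of E] E_K K_G by (auto intro!: card_image)
  finally have "2 * card E = card (E \<union> ?f ` E)" by simp
  also have "\<dots> \<le> card K" using E_K k by (intro card_mono finite_K) auto
  finally show ?thesis .
qed

text \<open>Let A be the pointwise stabilizer and let \<open>u\<close> translate \<open>B\<close> by
  t, not 0 modulo 3. The elements of A, u A and u^2 A translate \<open>B\<close> by 0, t and 2 t, so
  these three sets of equal size are disjoint.\<close>

lemma three_card_pointwise_stabilizer:
  assumes B: "B \<in> \<B>"
  shows "3 * card {c \<in> E. \<forall>x\<in>B. c x = x} \<le> card E"
proof -
  let ?A = "{c \<in> E. \<forall>x\<in>B. c x = x}"
  obtain u where u: "u \<in> E" "\<not> 3 dvd tr u B" using exists_E_three_cycle[OF B] by blast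
  let ?f = "\<lambda>h. u \<cdot> h" and ?g = "\<lambda>h. (u \<cdot> u) \<cdot> h"
  have uu: "u \<cdot> u \<in> E" using u by simp
  have uG: "u \<in> G" "u \<cdot> u \<in> G" using u uu E_K K_G by auto
  have A: "3 dvd tr c B" if "c \<in> ?A" for c
  proof -
    have c: "c \<in> E" using that by simp
    obtain x where "x \<in> B" using l_points[OF B] by blast
    thus ?thesis using tr_fixed_point[OF K_G[OF E_K[OF c]] B E_eta[OF c B]] that by blast
  qed
  have f: "3 dvd (tr (?f c) B - tr u B)" if "c \<in> ?A" for c
    using A[OF that] tr_mult_E[OF u(1) _ B, of c] that by simp presburger
  have g: "3 dvd (tr (?g c) B - 2 * tr u B)" if "c \<in> ?A" for c
    using A[OF that] tr_mult_E[OF uu _ B, of c] tr_mult_E[OF u(1) u(1) B] that by simp presburger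
  have 1: "?A \<inter> ?f ` ?A = {}"
  proof -
    have "False" if "c \<in> ?A" "?f c \<in> ?A" for c
      using dvd_diff[OF A[OF that(2)] f[OF that(1)]] u(2) by simp
    thus ?thesis by blast
  qed
  have 2: "(?A \<union> ?f ` ?A) \<inter> ?g ` ?A = {}"
  proof -
    have "False" if "c \<in> ?A" "?g c \<in> ?A" for c
    proof -
      have "3 dvd 2 * tr u B" using dvd_diff[OF A[OF that(2)] g[OF that(1)]] by simp
      hence "3 dvd tr u B" by presburger
      with u(2) show False by simp
    qed
    note no_A = this
    have no_f: "False" if "c \<in> ?A" "d \<in> ?A" "?g c = ?f d" for c d
    proof -
      have "3 dvd tr u B" using dvd_diff[OF f[OF that(2)] g[OF that(1)]] that(3) by simp
      with u(2) show False by simp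
    qed
    show ?thesis
    proof (rule equals0I)
      fix z assume z: "z \<in> (?A \<union> ?f ` ?A) \<inter> ?g ` ?A"
      then obtain c where c: "c \<in> ?A" "z = ?g c" by (elim IntE imageE)
      from z have "z \<in> ?A \<or> z \<in> ?f ` ?A" by (elim IntE UnE) simp_all
      thus False
      proof
        assume "z \<in> ?A"
        hence "?g c \<in> ?A" by (simp only: c(2))
        with c(1) show False by (rule no_A)
      next
        assume "z \<in> ?f ` ?A"
        then obtain d where d: "d \<in> ?A" "z = ?f d" by (elim imageE)
        have "?g c = ?f d" using c(2) d(2) by (simp only:)
        with c(1) d(1) show False by (rule no_f)
      qed
    qed
  qed
  have AG: "?A \<subseteq> G" using E_K K_G by blast
  have fin: "finite ?A" using finite_E by simp
  have "card (?A \<union> ?f ` ?A \<union> ?g ` ?A) = card ?A + card (?f ` ?A) + card (?g ` ?A)"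
    using 1 2 fin by (simp add: card_Un_disjoint)
  also have "\<dots> = 3 * card ?A"
    using card_image[OF left_mult_inj[OF uG(1) AG]] card_image[OF left_mult_inj[OF uG(2) AG]] by simp
  finally have "3 * card ?A = card (?A \<union> ?f ` ?A \<union> ?g ` ?A)" by simp
  also have "\<dots> \<le> card E" using u uu by (intro card_mono finite_E) auto
  finally show ?thesis .
qed

section \<open>Upper bound for intersecting families\<close>

lemma agree_quotient:
  assumes "f \<in> G" "g \<in> G" "x \<in> \<Omega>" "f x = g x"
  obtains B where "B \<in> \<B>" "g x \<in> B" "(f \<cdot> iv g) (g x) = g x" "(f \<cdot> iv g) ` B = B"
proof -
  obtain B where B: "B \<in> \<B>" "g x \<in> B" using in_some_block[of "g x"] assms by auto
  have fixed: "(f \<cdot> iv g) (g x) = g x" using assms by simp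
  moreover have "(f \<cdot> iv g) ` B = B"
    using fixed_point_block[OF _ B] fixed B(2) assms by simp
  ultimately show thesis using that B by blast
qed

text \<open>\<open>\<sigma>\<close> models the passage to the quotient of the induced group by its
  normal subgroup of order \<open>p\<close>, with values in \<open>R\<close>.
  \<open>sigma_eq\<close> reflects that this subgroup acts regularly on blocks, and
  \<open>two_blocks\<close> that a non-identity element of AGL(1,p) fixes at most one point.\<close>

context
  fixes F :: "('a \<Rightarrow> 'a) set" and \<sigma> :: "('a \<Rightarrow> 'a) \<Rightarrow> 'b" and R :: "'b set"
  assumes F_G: "F \<subseteq> G" and F_int: "intersecting \<Omega> F" and finite_R: "finite R"
    and sigma_R: "\<And>g. g \<in> G \<Longrightarrow> \<sigma> g \<in> R"
    and sigma_eq: "\<And>g h B. g \<in> G \<Longrightarrow> h \<in> G \<Longrightarrow> \<sigma> g = \<sigma> h \<Longrightarrow> B \<in> \<B> \<Longrightarrow>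
        (g \<cdot> iv h) ` B = B \<Longrightarrow> g \<cdot> iv h \<in> K"
    and sigma_K: "\<And>g h. g \<in> G \<Longrightarrow> h \<in> G \<Longrightarrow> g \<cdot> iv h \<in> K \<Longrightarrow> \<sigma> g = \<sigma> h"
    and two_blocks: "\<And>g B B'. g \<in> G \<Longrightarrow> B \<in> \<B> \<Longrightarrow> B' \<in> \<B> \<Longrightarrow> B \<noteq> B' \<Longrightarrow>
        g ` B = B \<Longrightarrow> g ` B' = B' \<Longrightarrow> g \<in> K"
begin

lemma agree: "f \<in> F \<Longrightarrow> g \<in> F \<Longrightarrow> \<exists>x\<in>\<Omega>. f x = g x"
  using F_int by (simp add: intersecting_def)

text \<open>Agreement at a point makes the quotient fix a block, and within a fibre of
  \<open>\<sigma>\<close> this forces it into \<open>K\<close>.\<close>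

lemma same_sigma_K:
  assumes "f \<in> F" "g \<in> F" "\<sigma> f = \<sigma> g"
  shows "f \<cdot> iv g \<in> K"
proof -
  obtain x where x: "x \<in> \<Omega>" "f x = g x" using agree[OF assms(1,2)] by blast
  have fg: "f \<in> G" "g \<in> G" using assms F_G by auto
  obtain B where "B \<in> \<B>" "(f \<cdot> iv g) ` B = B" using agree_quotient[OF fg x] by blast
  thus ?thesis using sigma_eq[OF fg assms(3)] by blast
qed

text \<open>
  All elements of one fibre of \<open>\<sigma>\<close> meet a fixed member of another fibre over one and the same
  block; agreeing in sign, they coincide with it on that whole block.
\<close>

lemma fibre_bound:
  assumes f0: "f0 \<in> F" "eps f0 = e" and f': "f' \<in> F" "eps f' = e" and ne: "\<sigma> f0 \<noteq> \<sigma> f'"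
  shows "3 * card {f \<in> F. eps f = e \<and> \<sigma> f = \<sigma> f0} \<le> card E"
proof -
  have G: "f0 \<in> G" "f' \<in> G" using f0 f' F_G by auto
  obtain x where x: "x \<in> \<Omega>" "f0 x = f' x" using agree[OF f0(1) f'(1)] by blast
  obtain B where B: "B \<in> \<B>" "f' x \<in> B" "(f0 \<cdot> iv f') (f' x) = f' x" "(f0 \<cdot> iv f') ` B = B"
    using agree_quotient[OF G x] .
  have on_B: "(f \<cdot> iv f') z = z" if f: "f \<in> F" "eps f = e" "\<sigma> f = \<sigma> f0" and z: "z \<in> B" for f z
  proof -
    have fG: "f \<in> G" using f F_G by auto
    obtain x1 where x1: "x1 \<in> \<Omega>" "f x1 = f' x1" using agree[OF f(1) f'(1)] by blast
    obtain B1 where B1: "B1 \<in> \<B>" "f' x1 \<in> B1" "(f \<cdot> iv f') (f' x1) = f' x1" "(f \<cdot> iv f') ` B1 = B1"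
      using agree_quotient[OF fG G(2) x1] .
    have k: "f \<cdot> iv f0 \<in> K" using same_sigma_K[OF f(1) f0(1) f(3)] .
    \<comment> \<open>The first factor lies in \<open>K\<close>, so both quotients by
      \<open>f'\<close> move blocks in the same way and fix the same ones.\<close>
    have eq: "f \<cdot> iv f' = (f \<cdot> iv f0) \<cdot> (f0 \<cdot> iv f')"
      using fG G by (intro G_eqI) auto
    have "(f0 \<cdot> iv f') ` B1 = B1"
    proof -
      have "(f \<cdot> iv f') ` B1 = (f \<cdot> iv f0) ` ((f0 \<cdot> iv f') ` B1)"
        unfolding eq using fG G B1 by (intro image_mult) auto
      also have "\<dots> = (f0 \<cdot> iv f') ` B1"
        using G B1 by (intro K_image[OF k] image_block) auto
      finally show ?thesis using B1(4) by simp
    qed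
    moreover have "f0 \<cdot> iv f' \<notin> K" using sigma_K G ne by blast
    \<comment> \<open>Since \<open>\<sigma>\<close> separates \<open>f0\<close> and
      \<open>f'\<close>, their quotient lies outside \<open>K\<close> and fixes only one
      block.\<close>
    ultimately have "B1 = B" using two_blocks[of "f0 \<cdot> iv f'" B B1] B B1 G by auto
    have gG: "f \<cdot> iv f' \<in> G" using fG G by simp
    \<comment> \<open>Equal signs make the quotient even, so its fixed point in \<open>B\<close>
      makes it trivial on \<open>B\<close>.\<close>
    have eta: "eta (f \<cdot> iv f') B = 1"
      using eta_const[OF gG B(1)] eps_quotient[OF fG G(2)] f f' by (simp add: eps_def)
    have B1': "f' x1 \<in> B" "(f \<cdot> iv f') ` B = B" using B1 \<open>B1 = B\<close> by auto
    have "3 dvd tr (f \<cdot> iv f') B" using tr_fixed_point[OF gG B(1) eta B1'(1) B1(3)] .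
    thus ?thesis by (rule fixed_pointwise[OF gG B(1) B1'(2) eta _ z])
  qed
  let ?S = "{f \<in> F. eps f = e \<and> \<sigma> f = \<sigma> f0}" and ?A = "{c \<in> E. \<forall>x\<in>B. c x = x}"
  \<comment> \<open>\<open>f\<close> and \<open>f0\<close> both agree with \<open>f'\<close> over
    all of \<open>B\<close>, so \<open>f \<cdot> iv f0\<close> fixes \<open>B\<close> pointwise; the
    common fibre and sign place it in \<open>E\<close>.\<close>
  have "(\<lambda>f. f \<cdot> iv f0) ` ?S \<subseteq> ?A"
  proof clarify
    fix f assume f: "f \<in> F" "e = eps f" "\<sigma> f = \<sigma> f0"
    have fG: "f \<in> G" using f F_G by auto
    have "f \<cdot> iv f0 \<in> E"
      using same_sigma_K[OF f(1) f0(1) f(3)] eps_quotient[OF fG G(1)] f f0 by (simp add: E_iff)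
    moreover have "(f \<cdot> iv f0) z = z" if z: "z \<in> B" for z
    proof -
      have zO: "z \<in> \<Omega>" using z B block_sub by blast
      have 0: "f0 (iv f' z) = z" using on_B[OF f0(1,2) refl z] G zO by simp
      have 1: "f (iv f' z) = z" using on_B[OF f(1) _ f(3) z] f(2) fG G zO by simp
      have "iv f0 z = iv f' z" using iv_app[OF G(1), of "iv f' z"] 0 zO G by simp
      thus ?thesis using 1 fG G zO by simp
    qed
    ultimately show "f \<cdot> iv f0 \<in> E \<and> (\<forall>x\<in>B. (f \<cdot> iv f0) x = x)" by blast
  qed
  moreover have "inj_on (\<lambda>f. f \<cdot> iv f0) ?S"
    using G F_G by (intro right_mult_inj) auto
  ultimately have "card ?S \<le> card ?A"
    using finite_E by (intro card_inj_on_le) auto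
  thus ?thesis using three_card_pointwise_stabilizer[OF B(1)] by linarith
qed

text \<open>If two values of \<open>\<sigma>\<close> occur in the class, each of the at most
  \<open>card R\<close> fibres has at most |E|/3 elements by \<open>fibre_bound\<close>. Otherwise
  the class lies in one coset of \<open>E\<close>.\<close>

lemma sign_class_bound:
  "3 * card {f \<in> F. eps f = e} \<le> card E * max 3 (card R)"
proof (cases "\<exists>f1\<in>F. \<exists>f2\<in>F. eps f1 = e \<and> eps f2 = e \<and> \<sigma> f1 \<noteq> \<sigma> f2")
  case True
  then obtain f1 f2 where f12: "f1 \<in> F" "f2 \<in> F" "eps f1 = e" "eps f2 = e" "\<sigma> f1 \<noteq> \<sigma> f2" by blast
  let ?S = "\<lambda>s. {f \<in> F. eps f = e \<and> \<sigma> f = s}"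
  have S: "3 * card (?S s) \<le> card E" for s
  proof (cases "?S s = {}")
    case False
    then obtain f0 where f0: "f0 \<in> F" "eps f0 = e" "\<sigma> f0 = s" by blast
    \<comment> \<open>At least one of \<open>f1\<close> and \<open>f2\<close> lies outside the fibre
      of \<open>f0\<close>.\<close>
    then obtain f' where "f' \<in> F" "eps f' = e" "\<sigma> f0 \<noteq> \<sigma> f'" using f12 by metis
    from fibre_bound[OF f0(1,2) this] f0(3) show ?thesis by simp
  next
    case True
    show ?thesis unfolding True by simp
  qed
  have "{f \<in> F. eps f = e} = (\<Union>s\<in>R. ?S s)" using sigma_R F_G by auto
  hence "card {f \<in> F. eps f = e} \<le> (\<Sum>s\<in>R. card (?S s))"
    using card_UN_le[OF finite_R] by simp
  hence "3 * card {f \<in> F. eps f = e} \<le> (\<Sum>s\<in>R. 3 * card (?S s))"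
    by (simp add: sum_distrib_left[symmetric])
  also have "\<dots> \<le> card R * card E" using sum_bounded_above[of R "\<lambda>s. 3 * card (?S s)" "card E"] S by simp
  also have "\<dots> \<le> card E * max 3 (card R)" by (simp add: mult.commute)
  finally show ?thesis .
next
  case False
  show ?thesis
  proof (cases "{f \<in> F. eps f = e} = {}")
    case True
    show ?thesis unfolding True by simp
  next
    case nonempty: False
    then obtain f0 where f0: "f0 \<in> F" "eps f0 = e" by blast
    have G: "f0 \<in> G" using f0 F_G by auto
    have "(\<lambda>f. f \<cdot> iv f0) ` {f \<in> F. eps f = e} \<subseteq> E"
    proof clarify
      fix f assume f: "f \<in> F" "e = eps f"
      have "\<sigma> f = \<sigma> f0" using False f f0 by blast
      thus "f \<cdot> iv f0 \<in> E"
        using same_sigma_K[OF f(1) f0(1)] eps_quotient[OF subsetD[OF F_G f(1)] G] f f0(2)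
        by (simp add: E_iff)
    qed
    moreover have "inj_on (\<lambda>f. f \<cdot> iv f0) {f \<in> F. eps f = e}"
      using G F_G by (intro right_mult_inj) auto
    ultimately have "card {f \<in> F. eps f = e} \<le> card E"
      using finite_E by (intro card_inj_on_le) auto
    hence "3 * card {f \<in> F. eps f = e} \<le> card E * 3" by simp
    also have "\<dots> \<le> card E * max 3 (card R)" by (intro mult_left_mono) auto
    finally show ?thesis .
  qed
qed

lemma intersecting_bound: "3 * card F \<le> card K * max 3 (card R)"
proof -
  have "eps f = 1 \<or> eps f = -1" if "f \<in> F" for f
    by (rule eps_cases) (use that F_G in blast)
  hence "{f \<in> F. eps f = 1} \<union> {f \<in> F. eps f = -1} = F" by blast
  with card_Un_le[of "{f \<in> F. eps f = 1}" "{f \<in> F. eps f = -1}"]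
  have "card F \<le> card {f \<in> F. eps f = 1} + card {f \<in> F. eps f = -1}" by simp
  hence "3 * card F \<le> 2 * card E * max 3 (card R)"
    using sign_class_bound[of 1] sign_class_bound[of "-1"] by linarith
  also have "\<dots> \<le> card K * max 3 (card R)" using two_card_E by (intro mult_right_mono) auto
  finally show ?thesis .
qed

end

end

section \<open>The induced action on blocks\<close>

context triple_system
begin

abbreviation bp :: "('a \<Rightarrow> 'a) \<Rightarrow> 'a set \<Rightarrow> 'a set" where
  "bp \<equiv> block_perm \<B>"

sublocale Blocks: group "BijGroup \<B>"
  by (rule group_BijGroup)

lemma bp_app: "B \<in> \<B> \<Longrightarrow> bp g B = g ` B"
  by (simp add: block_perm_def)

lemma bp_carrier [simp]:
  assumes g: "g \<in> G"
  shows "bp g \<in> carrier (BijGroup \<B>)"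
proof -
  have "bij_betw (bp g) \<B> \<B>"
  proof (rule bij_betw_byWitness[where f' = "bp (iv g)"])
    show "\<forall>B\<in>\<B>. bp (iv g) (bp g B) = B" "\<forall>B\<in>\<B>. bp g (bp (iv g) B) = B"
      using g by (simp_all add: bp_app image_block)
    show "bp g ` \<B> \<subseteq> \<B>" "bp (iv g) ` \<B> \<subseteq> \<B>"
      using g by (auto simp: bp_app image_block)
  qed
  thus ?thesis by (simp add: BijGroup_def Bij_def block_perm_def)
qed

lemma bp_mult:
  assumes "g \<in> G" "h \<in> G"
  shows "bp (g \<cdot> h) = bp g \<otimes>\<^bsub>BijGroup \<B>\<^esub> bp h"
proof
  fix B
  have "bp g \<otimes>\<^bsub>BijGroup \<B>\<^esub> bp h = compose \<B> (bp g) (bp h)"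
    using bp_carrier[OF assms(1)] bp_carrier[OF assms(2)] by (simp add: BijGroup_def)
  thus "bp (g \<cdot> h) B = (bp g \<otimes>\<^bsub>BijGroup \<B>\<^esub> bp h) B"
    using assms by (simp add: compose_def block_perm_def image_mult image_block)
qed

lemma bp_one: "bp \<one>\<^bsub>BijGroup \<Omega>\<^esub> = \<one>\<^bsub>BijGroup \<B>\<^esub>"
proof
  fix B
  show "bp \<one>\<^bsub>BijGroup \<Omega>\<^esub> B = \<one>\<^bsub>BijGroup \<B>\<^esub> B"
    using K_image[OF K_one, of B] by (simp add: block_perm_def BijGroup_def)
qed

lemma bp_iv: "g \<in> G \<Longrightarrow> bp (iv g) = inv\<^bsub>BijGroup \<B>\<^esub> bp g"
  using bp_mult[of "iv g" g] bp_one G_carrier[of g]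
  by (intro Blocks.inv_equality[symmetric]) auto

lemma bp_pw: "g \<in> G \<Longrightarrow> bp (pw g n) = bp g [^]\<^bsub>BijGroup \<B>\<^esub> n"
  by (induction n) (simp_all add: bp_one bp_mult)

lemma K_iff_bp: "k \<in> K \<longleftrightarrow> k \<in> G \<and> bp k = \<one>\<^bsub>BijGroup \<B>\<^esub>"
proof (intro iffI conjI)
  assume "k \<in> K"
  thus "k \<in> G" by (rule K_G)
  show "bp k = \<one>\<^bsub>BijGroup \<B>\<^esub>"
  proof
    fix B show "bp k B = \<one>\<^bsub>BijGroup \<B>\<^esub> B"
      using K_image[OF \<open>k \<in> K\<close>, of B] by (simp add: block_perm_def BijGroup_def)
  qed
next
  assume k: "k \<in> G \<and> bp k = \<one>\<^bsub>BijGroup \<B>\<^esub>"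
  have "k ` B = B" if "B \<in> \<B>" for B
    using bp_app[OF that, of k] k that by (simp add: BijGroup_def)
  with k show "k \<in> K" by (simp add: K_def)
qed

lemma block_kernel_eq: "block_kernel \<Omega> \<B> G = K"
  by (auto simp: block_kernel_def kernel_def K_iff_bp)

lemma bp_eq_iff:
  assumes "g \<in> G" "h \<in> G"
  shows "bp g = bp h \<longleftrightarrow> g \<cdot> iv h \<in> K"
  using assms Blocks.inv_solve_right'[of "\<one>\<^bsub>BijGroup \<B>\<^esub>" "bp g" "bp h"]
  by (auto simp: K_iff_bp bp_mult bp_iv)

text \<open>Right multiplication by an element of a fibre of \<open>bp\<close> identifies
  \<open>K\<close> with that fibre, so all fibres over the induced group have size |K|.\<close>

lemma card_G: "card G = card K * card (bp ` G)"
proof -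
  have "card {g \<in> G. bp g = \<gamma>} = card K" if "\<gamma> \<in> bp ` G" for \<gamma>
  proof -
    from that obtain g where g: "g \<in> G" "\<gamma> = bp g" by auto
    have "bij_betw (\<lambda>h. h \<cdot> iv g) {h \<in> G. bp h = \<gamma>} K"
    proof (rule bij_betw_byWitness[where f' = "\<lambda>k. k \<cdot> g"])
      show "\<forall>h\<in>{h \<in> G. bp h = \<gamma>}. h \<cdot> iv g \<cdot> g = h"
        using g by (auto intro!: G_eqI)
      show "\<forall>k\<in>K. k \<cdot> g \<cdot> iv g = k"
        using g K_G by (auto intro!: G_eqI)
      show "(\<lambda>h. h \<cdot> iv g) ` {h \<in> G. bp h = \<gamma>} \<subseteq> K"
        using g bp_eq_iff by auto
      show "(\<lambda>k. k \<cdot> g) ` K \<subseteq> {h \<in> G. bp h = \<gamma>}"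
        using g by (auto simp: K_iff_bp bp_mult)
    qed
    thus ?thesis by (rule bij_betw_same_card)
  qed
  hence "(\<Sum>\<gamma>\<in>bp ` G. card {g \<in> G. bp g = \<gamma>}) = card (bp ` G) * card K" by simp
  moreover have "card G = (\<Sum>\<gamma>\<in>bp ` G. card {g \<in> G. bp g = \<gamma>})"
    using finite_G sum.image_gen[of G "\<lambda>_. 1::nat" bp] by simp
  ultimately show ?thesis by simp
qed

end

section \<open>Auxiliary facts on cycles, affine maps and factorizations\<close>

lemma cycle_enumeration:
  fixes \<alpha> :: "'b \<Rightarrow> 'b"
  assumes "is_cycle_of_length S p \<alpha>" "finite S" "card S = p" "p > 0"
  obtains e :: "nat \<Rightarrow> 'b" where "range e = S" "\<And>i j. e i = e j \<longleftrightarrow> [i = j] (mod p)"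
    "\<And>i. \<alpha> (e i) = e (Suc i)"
proof -
  obtain cs where cs: "distinct cs" "length cs = p" "set cs \<subseteq> S" "\<alpha> = restrict (cycle_of_list cs) S"
    using assms(1) by (auto simp: is_cycle_of_length_def)
  \<comment> \<open>A list of \<open>p\<close> distinct points exhausts \<open>S\<close>, so
    positions modulo \<open>p\<close> enumerate it cyclically.\<close>
  have S: "set cs = S"
    using cs assms by (intro card_subset_eq) (auto simp: distinct_card)
  define e where "e i = cs ! (i mod p)" for i
  have "range e = S"
  proof
    show "range e \<subseteq> S" using cs assms(4) S nth_mem by (auto simp: e_def)
    show "S \<subseteq> range e"
    proof
      fix x assume "x \<in> S"
      then obtain i where "i < p" "x = cs ! i" using S cs(2) by (metis in_set_conv_nth)
      hence "x = e i" by (simp add: e_def)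
      thus "x \<in> range e" by blast
    qed
  qed
  moreover have "e i = e j \<longleftrightarrow> [i = j] (mod p)" for i j
    using cs assms(4) by (simp add: e_def nth_eq_iff_index_eq cong_def)
  moreover have "\<alpha> (e i) = e (Suc i)" for i
  proof -
    have lt: "i mod p < p" using assms(4) by simp
    have "map (cycle_of_list cs) cs = rotate 1 cs" using cyclic_rotation[OF cs(1), of 1] by simp
    hence "cycle_of_list cs (cs ! (i mod p)) = rotate 1 cs ! (i mod p)"
      using nth_map[of "i mod p" cs] lt cs(2) by metis
    also have "\<dots> = cs ! ((1 + i mod p) mod p)"
      using nth_rotate[of "i mod p" cs 1] lt cs(2) by simp
    also have "\<dots> = e (Suc i)" by (simp add: e_def mod_Suc_eq)
    finally have "cycle_of_list cs (e i) = e (Suc i)" by (simp add: e_def)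
    moreover have "e i \<in> S" using \<open>range e = S\<close> by blast
    ultimately show ?thesis using cs(4) by simp
  qed
  ultimately show thesis using that by blast
qed

text \<open>Subtracting the two fixed-point equations gives (c - 1) (f x - f y) = 0 modulo p, so c =
  1 and then e = 0. Applied to blocks, this shows that an element of \<open>G\<close> fixing two
  blocks lies in the kernel.\<close>

lemma AGL1_two_fixed_points:
  assumes p: "prime p"
    and emb: "perm_embeds S H (carrier (residue_ring (int p))) (AGL1 (residue_ring (int p)))"
    and g: "g \<in> H" and xy: "x \<in> S" "y \<in> S" "x \<noteq> y" "g x = x" "g y = y"
    and z: "z \<in> S" "g z \<in> S"
  shows "g z = z"
proof -
  let ?R = "residue_ring (int p)"
  obtain f where f: "bij_betw f S (carrier ?R)"
    "\<And>g. g \<in> H \<Longrightarrow> \<exists>k\<in>AGL1 ?R. \<forall>x\<in>S. f (g x) = k (f x)"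
    using emb by (auto simp: perm_embeds_def)
  obtain k where k: "k \<in> AGL1 ?R" "\<And>x. x \<in> S \<Longrightarrow> f (g x) = k (f x)"
    using f(2)[OF g] by blast
  obtain c e where ce: "k = (\<lambda>x\<in>carrier ?R. (c \<otimes>\<^bsub>?R\<^esub> x) \<oplus>\<^bsub>?R\<^esub> e)" "e \<in> carrier ?R"
    using k(1) by (auto simp: AGL1_def)
  have range: "0 \<le> f u \<and> f u < int p" if "u \<in> S" for u
    using bij_betwE[OF f(1)] that by (auto simp: residue_ring_def)
  have k_eq: "f (g u) = (c * f u + e) mod int p" if "u \<in> S" for u
    using k(2)[OF that] bij_betwE[OF f(1)] that
    by (simp add: ce(1) residue_ring_def mod_add_left_eq)
  have dvd: "int p dvd (c * f u + e - f u)" if "u \<in> S" "g u = u" for u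
    using k_eq[OF that(1)] range[OF that(1)] that(2)
    by (metis mod_eq_dvd_iff mod_pos_pos_trivial)
  have "int p dvd (c * f x + e - f x) - (c * f y + e - f y)"
    by (intro dvd_diff dvd xy)
  also have "(c * f x + e - f x) - (c * f y + e - f y) = (c - 1) * (f x - f y)"
    by (simp add: algebra_simps)
  finally have "int p dvd c - 1 \<or> int p dvd f x - f y"
    using p by (simp add: prime_dvd_mult_iff)
  moreover have "\<not> int p dvd f x - f y"
  proof
    assume "int p dvd f x - f y"
    hence "f x mod int p = f y mod int p" by (simp add: mod_eq_dvd_iff)
    hence "f x = f y" using range[of x] range[of y] xy by simp
    thus False using bij_betw_imp_inj_on[OF f(1)] xy by (meson inj_onD)
  qed
  ultimately have c: "int p dvd c - 1" by blast
  have "int p dvd (c * f x + e - f x) - (c - 1) * f x"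
    by (rule dvd_diff[OF dvd[OF xy(1,4)] dvd_mult2[OF c]])
  also have "(c * f x + e - f x) - (c - 1) * f x = e" by (simp add: algebra_simps)
  finally have e: "int p dvd e" .
  have "int p dvd (c - 1) * f z + e" using c e by simp
  also have "(c - 1) * f z + e = c * f z + e - f z" by (simp add: algebra_simps)
  finally have "(c * f z + e) mod int p = f z mod int p" by (simp add: mod_eq_dvd_iff)
  hence "f (g z) = f z" using k_eq[OF z(1)] range[OF z(1)] by simp
  thus ?thesis using bij_betw_imp_inj_on[OF f(1)] z by (meson inj_onD)
qed

text \<open>The elements x'^-1 x and y' y^-1 are equal, hence lie in the trivial
  intersection.\<close>

lemma (in group) semidirect_factorization_unique:
  assumes "subgroup A G" "subgroup D G" "A \<inter> D = {\<one>}"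
    and "x \<in> A" "x' \<in> A" "y \<in> D" "y' \<in> D" "x \<otimes> y = x' \<otimes> y'"
  shows "x = x'" "y = y'"
proof -
  have c: "x \<in> carrier G" "x' \<in> carrier G" "y \<in> carrier G" "y' \<in> carrier G"
    using assms subgroup.mem_carrier by metis+
  have "inv x' \<otimes> x = y' \<otimes> inv y"
    using assms(8) c by (metis inv_closed inv_solve_left' inv_solve_right m_assoc m_closed)
  moreover have "inv x' \<otimes> x \<in> A" "y' \<otimes> inv y \<in> D"
    using assms subgroup.m_closed subgroup.m_inv_closed by metis+
  ultimately have 1: "inv x' \<otimes> x = \<one>" "y' \<otimes> inv y = \<one>" using assms(3) by auto
  show "x = x'" using 1(1) c by (metis inv_equality inv_inv inv_closed)
  show "y = y'" using 1(2) c by (metis inv_equality inv_inv inv_closed)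
qed

theorem theorem8p3:
  fixes p d :: nat and t :: int
    and \<Omega> :: "'a set" and G K :: "('a \<Rightarrow> 'a) set"
    and \<B> :: "'a set set" and B1 :: "'a set"
    and Gbar :: "('a set \<Rightarrow> 'a set) set"
    and \<alpha> \<beta> :: "'a set \<Rightarrow> 'a set" and a b :: "'a \<Rightarrow> 'a" and \<omega> :: 'a
  assumes "prime p" and "p \<ge> 5"
    and "finite \<Omega>" and "card \<Omega> = 3 * p"
    and "subgroup G (BijGroup \<Omega>)" and "transitive_on \<Omega> G"
    and "nontrivial_invariant_partition \<Omega> G \<B>"
    and "\<And>P. nontrivial_invariant_partition \<Omega> G P \<Longrightarrow> P = \<B>"
    and "card \<B> = p" and "\<And>B. B \<in> \<B> \<Longrightarrow> card B = 3" and "B1 \<in> \<B>"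
    and "Gbar = induced_group \<B> G" and "K = block_kernel \<Omega> \<B> G"
    and "K \<noteq> {\<one>\<^bsub>BijGroup \<Omega>\<^esub>}"
    and "\<And>g. g \<in> K \<Longrightarrow> \<not> derangement \<Omega> g"
    and "\<And>N. minimal_normal N (perm_group \<Omega> G) \<Longrightarrow> N \<subseteq> K \<Longrightarrow>
           elementary_abelian 3 (perm_group \<Omega> N)"
    and "\<exists>g\<in>K. group.ord (BijGroup \<Omega>) g = 2"
    and "solvable (perm_group \<B> Gbar)"
    and "perm_embeds \<B> Gbar (carrier (residue_ring (int p))) (AGL1 (residue_ring (int p)))"
    and "\<alpha> \<in> Gbar" and "\<beta> \<in> Gbar"
    and "internal_semidirect (perm_group \<B> Gbar)
           (generate (BijGroup \<B>) {\<alpha>}) (generate (BijGroup \<B>) {\<beta>})"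
    and "is_cycle_of_length \<B> p \<alpha>"
    and "group.ord (BijGroup \<B>) \<beta> = d" and "d dvd p - 1"
    and "\<beta> B1 = B1"
    and "\<beta> \<otimes>\<^bsub>BijGroup \<B>\<^esub> \<alpha> \<otimes>\<^bsub>BijGroup \<B>\<^esub> inv\<^bsub>BijGroup \<B>\<^esub> \<beta> = \<alpha> [^]\<^bsub>BijGroup \<B>\<^esub> t"
    and "coprime t (int p)"
    and "a \<in> G" and "semiregular \<Omega> a" and "group.ord (BijGroup \<Omega>) a = p"
    and "block_perm \<B> a = \<alpha>"
    and "b \<in> G" and "block_perm \<B> b = \<beta>"
    and "\<omega> \<in> \<Omega>"
  shows "intersection_density \<Omega> (generate (BijGroup \<Omega>) (K \<union> {a, b})) \<omega> = max 1 (3 / real d)"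
proof -
  note prime_p = assms(1) and p5 = assms(2) and fin = assms(3) and card_\<Omega> = assms(4)
    and subG = assms(5) and transG = assms(6) and nip = assms(7) and uniq = assms(8)
    and card_\<B> = assms(9) and card3 = assms(10) and Gbar = assms(12) and Kdef = assms(13)
    and K_ne = assms(14) and K_nd = assms(15) and K_inv = assms(17) and emb = assms(19)
    and \<alpha>_in = assms(20) and \<beta>_in = assms(21) and semi = assms(22) and cyc = assms(23)
    and ord_\<beta> = assms(24) and d_dvd = assms(25) and aG = assms(29) and ord_a = assms(31)
    and bp_a = assms(32) and bG = assms(33) and bp_b = assms(34) and \<omega> = assms(35)

  \<comment> \<open>The block system and its labelling\<close>
  interpret T: triple_system \<Omega> G \<B>
    using fin subG nip card3
    by (intro triple_system.intro) (auto simp: nontrivial_invariant_partition_def)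
  let ?S = "BijGroup \<B>" and ?times = "T.times_perm" and ?bp = "block_perm \<B>"
  have K_eq: "K = T.K" using Kdef T.block_kernel_eq by simp
  have p0: "p > 0" using p5 by simp
  have finB: "finite \<B>" using T.finite_blocks .
  \<comment> \<open>The enumeration follows the cycle \<open>\<alpha>\<close>, so that
    \<open>a\<close> shifts indices by one.\<close>
  obtain blk where blk: "range blk = \<B>" "\<And>i j. blk i = blk j \<longleftrightarrow> [i = j] (mod p)"
    "\<And>i. \<alpha> (blk i) = blk (Suc i)"
    by (rule cycle_enumeration[OF cyc finB card_\<B> p0]) (rule that)
  have blk_in: "blk i \<in> \<B>" for i using blk(1) by auto
  have a_blk: "a ` blk i = blk (Suc i)" for i
    using blk(3)[of i] bp_a T.bp_app[OF blk_in] by metis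
  have pw_a: "T.pw a p = \<one>\<^bsub>BijGroup \<Omega>\<^esub>"
    using T.Sym.pow_ord_eq_1[OF T.G_carrier[OF aG]] ord_a by simp
  have "odd p" using prime_odd_nat[OF prime_p] p5 by simp
  interpret C: cyclic_triple_system \<Omega> G \<B> a p blk
    by unfold_locales (fact prime_p \<open>odd p\<close> aG pw_a blk(1) blk(2) a_blk)+
  obtain l where l: "\<And>B. B \<in> \<B> \<Longrightarrow> bij_betw l B {0,1,2::int}" "\<And>x. x \<in> \<Omega> \<Longrightarrow> l (a x) = l x"
    using C.exists_labelling by blast

  \<comment> \<open>Orders and normality in the induced group\<close>
  define A where "A = generate ?S {\<alpha>}"
  define D where "D = generate ?S {\<beta>}"
  have \<alpha>_c: "\<alpha> \<in> carrier ?S" and \<beta>_c: "\<beta> \<in> carrier ?S"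
    using bp_a bp_b aG bG T.bp_carrier by blast+
  have \<alpha>_pow: "\<alpha> [^]\<^bsub>?S\<^esub> n = ?bp (T.pw a n)" for n :: nat
    using T.bp_pw[OF aG] bp_a by simp
  have "\<alpha> [^]\<^bsub>?S\<^esub> p = \<one>\<^bsub>?S\<^esub>" using \<alpha>_pow[of p] pw_a T.bp_one by simp
  hence "T.Blocks.ord \<alpha> dvd p" using T.Blocks.pow_eq_id[OF \<alpha>_c] by simp
  moreover have "T.Blocks.ord \<alpha> \<noteq> 1"
  proof
    assume "T.Blocks.ord \<alpha> = 1"
    hence "\<alpha> = \<one>\<^bsub>?S\<^esub>" using T.Blocks.ord_eq_1[OF \<alpha>_c] by simp
    hence "blk 0 = blk (Suc 0)" using blk(3)[of 0] blk_in[of 0] by (simp add: BijGroup_def)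
    thus False using blk(2)[of 0 "Suc 0"] p5 by (simp add: cong_def)
  qed
  ultimately have ord_\<alpha>: "T.Blocks.ord \<alpha> = p" using prime_p prime_nat_iff by blast
  \<comment> \<open>Order 0 would stand for infinite order; it is excluded because 0 divides
    \<open>p - 1\<close> only if \<open>p - 1 = 0\<close>.\<close>
  have d0: "d \<noteq> 0"
  proof
    assume "d = 0"
    with d_dvd p5 show False by simp
  qed
  have cardA: "card A = p" using T.Blocks.generate_pow_card[OF \<alpha>_c] ord_\<alpha> by (simp add: A_def)
  have cardD: "card D = d" using T.Blocks.generate_pow_card[OF \<beta>_c] ord_\<beta> by (simp add: D_def)
  have A_pow: "A = {\<alpha> [^]\<^bsub>?S\<^esub> n |n. n \<in> (UNIV :: nat set)}"
    using T.Blocks.generate_pow_nat[OF \<alpha>_c] ord_\<alpha> p0 by (simp add: A_def)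
  have D_pow: "D = {\<beta> [^]\<^bsub>?S\<^esub> n |n. n \<in> (UNIV :: nat set)}"
    using T.Blocks.generate_pow_nat[OF \<beta>_c] ord_\<beta> d0 by (simp add: D_def)
  have subA: "subgroup A ?S" and subD: "subgroup D ?S"
    unfolding A_def D_def using \<alpha>_c \<beta>_c by (auto intro: T.Blocks.generate_is_subgroup)
  have AD: "A \<inter> D = {\<one>\<^bsub>?S\<^esub>}"
    using semi by (simp add: internal_semidirect_def A_def D_def)
  have Gbar_AD: "Gbar = A <#>\<^bsub>?S\<^esub> D"
    using semi by (simp add: internal_semidirect_def A_def D_def set_mult_def)
  have bpG: "?bp ` G = Gbar" using Gbar by (simp add: induced_group_def)
  have subGbar: "subgroup Gbar ?S"
  proof (rule T.Blocks.subgroupI)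
    show "Gbar \<subseteq> carrier ?S" "Gbar \<noteq> {}" using bpG \<alpha>_in T.bp_carrier by auto
    show "inv\<^bsub>?S\<^esub> x \<in> Gbar" if "x \<in> Gbar" for x
      using that T.bp_iv[symmetric] unfolding bpG[symmetric] by auto
    show "x \<otimes>\<^bsub>?S\<^esub> y \<in> Gbar" if "x \<in> Gbar" "y \<in> Gbar" for x y
      using that T.bp_mult[symmetric] unfolding bpG[symmetric] by auto
  qed
  have A_normal: "x \<otimes>\<^bsub>?S\<^esub> y \<otimes>\<^bsub>?S\<^esub> inv\<^bsub>?S\<^esub> x \<in> A" if "x \<in> Gbar" "y \<in> A" for x y
  proof -
    have "A \<lhd> perm_group \<B> Gbar" using semi by (simp add: internal_semidirect_def A_def)
    from normal.inv_op_closed2[OF this, of x y] that show ?thesis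
      using T.Blocks.m_inv_consistent[OF subGbar that(1)] by simp
  qed

  have a_normal: "\<exists>n. \<exists>k\<in>T.K. ?times g a = ?times (?times (T.pw a n) k) g" if g: "g \<in> G" for g
  proof -
    have "?bp g \<in> Gbar" "\<alpha> \<in> A" using g bpG by (auto simp: A_def intro: generate.incl)
    from A_normal[OF this] obtain n where
      n: "?bp g \<otimes>\<^bsub>?S\<^esub> \<alpha> \<otimes>\<^bsub>?S\<^esub> inv\<^bsub>?S\<^esub> ?bp g = \<alpha> [^]\<^bsub>?S\<^esub> (n::nat)"
      unfolding A_pow by blast
    let ?h = "?times (?times g a) (T.iv g)" and ?q = "T.pw a n"
    \<comment> \<open>The conjugate \<open>?h\<close> of \<open>a\<close> and the power
      \<open>?q\<close> act alike on blocks, so \<open>?h\<close> times the inverse of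
      \<open>?q\<close> lies in \<open>K\<close>; conjugating it by the inverse of \<open>?q\<close>
      puts the kernel element to the right of \<open>?q\<close>.\<close>
    define k where "k = ?times (T.iv ?q) (?times (?times ?h (T.iv ?q)) ?q)"
    have G: "?h \<in> G" "?q \<in> G" using g aG by auto
    have "?bp ?h = ?bp ?q"
      using n g aG by (simp add: T.bp_mult T.bp_iv bp_a \<alpha>_pow)
    hence "?times ?h (T.iv ?q) \<in> T.K" using T.bp_eq_iff[OF G] by simp
    from T.K_conj[OF T.iv_closed[OF G(2)] this]
    have "k \<in> T.K" using G T.G_carrier by (simp add: k_def T.Sym.m_assoc)
    moreover have "?times g a = ?times (?times ?q k) g"
      using G g aG by (intro T.G_eqI) (auto simp: k_def)
    ultimately show ?thesis by blast
  qed

  have K_trans: "\<exists>k\<in>T.K. k x = y" if "B \<in> \<B>" "x \<in> B" "y \<in> B" for B x y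
    using T.K_transitive_on_blocks[OF _ _ uniq that] K_ne K_eq card_\<Omega> p5 by simp
  have K_invol: "\<exists>k\<in>T.K. k \<noteq> \<one>\<^bsub>BijGroup \<Omega>\<^esub> \<and> ?times k k = \<one>\<^bsub>BijGroup \<Omega>\<^esub>"
  proof -
    obtain k where k: "k \<in> T.K" "T.Sym.ord k = 2" using K_inv K_eq by blast
    have kc: "k \<in> carrier (BijGroup \<Omega>)" using T.G_carrier[OF T.K_G[OF k(1)]] .
    have "k \<noteq> \<one>\<^bsub>BijGroup \<Omega>\<^esub>" using k(2) by auto
    moreover have "T.pw k 2 = \<one>\<^bsub>BijGroup \<Omega>\<^esub>" using T.Sym.pow_ord_eq_1[OF kc] k(2) by simp
    hence "?times k k = \<one>\<^bsub>BijGroup \<Omega>\<^esub>" using kc by (simp add: numeral_2_eq_2)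
    ultimately show ?thesis using k(1) by blast
  qed
  have K_fix: "\<exists>x\<in>\<Omega>. k x = x" if "k \<in> T.K" for k
    using K_nd[of k] that K_eq by (simp add: derangement_def)
  interpret L: labelled_kernel_system \<Omega> G \<B> a p blk l
    by unfold_locales (fact l K_fix K_trans K_invol a_normal)+

  \<comment> \<open>Factorization of the induced group and the map \<open>\<sigma>\<close>\<close>
  have Gbar_factor: "\<exists>x\<in>A. \<exists>y\<in>D. \<gamma> = x \<otimes>\<^bsub>?S\<^esub> y" if "\<gamma> \<in> Gbar" for \<gamma>
    using that unfolding Gbar_AD set_mult_def by blast
  have factor_unique: "x = x' \<and> y = y'"
    if "x \<in> A" "x' \<in> A" "y \<in> D" "y' \<in> D" "x \<otimes>\<^bsub>?S\<^esub> y = x' \<otimes>\<^bsub>?S\<^esub> y'" for x x' y y'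
    using T.Blocks.semidirect_factorization_unique[OF subA subD AD that] by blast
  have A_c: "x \<in> carrier ?S" if "x \<in> A" for x using subgroup.mem_carrier[OF subA that] .
  have D_c: "x \<in> carrier ?S" if "x \<in> D" for x using subgroup.mem_carrier[OF subD that] .
  have cardGbar: "card Gbar = p * d"
  proof -
    have "Gbar = (\<lambda>(x, y). x \<otimes>\<^bsub>?S\<^esub> y) ` (A \<times> D)"
      unfolding Gbar_AD set_mult_def by auto
    moreover have "inj_on (\<lambda>(x, y). x \<otimes>\<^bsub>?S\<^esub> y) (A \<times> D)"
      using factor_unique by (auto simp: inj_on_def)
    ultimately show ?thesis
      by (simp add: card_image card_cartesian_product cardA cardD)
  qed

  \<comment> \<open>The \<open>D\<close>-component of the induced permutation. The choice depends on
    \<open>?bp g\<close> only, so it is constant on cosets of \<open>K\<close>.\<close>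
  define \<sigma> where "\<sigma> g = (SOME y. y \<in> D \<and> (\<exists>x\<in>A. ?bp g = x \<otimes>\<^bsub>?S\<^esub> y))" for g
  have \<sigma>: "\<sigma> g \<in> D \<and> (\<exists>x\<in>A. ?bp g = x \<otimes>\<^bsub>?S\<^esub> \<sigma> g)" if "g \<in> G" for g
  proof -
    have "?bp g \<in> Gbar" using that bpG by blast
    hence "\<exists>y. y \<in> D \<and> (\<exists>x\<in>A. ?bp g = x \<otimes>\<^bsub>?S\<^esub> y)" using Gbar_factor by blast
    thus ?thesis unfolding \<sigma>_def by (rule someI_ex)
  qed
  \<comment> \<open>The common \<open>D\<close>-component cancels, so the quotient acts on blocks as
    a power of \<open>\<alpha>\<close>; fixing a block, this power shifts indices by a multiple of
    \<open>p\<close>.\<close>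
  have \<sigma>_eq: "T.times_perm g (T.iv h) \<in> T.K"
    if g: "g \<in> G" and h: "h \<in> G" and eq: "\<sigma> g = \<sigma> h" and B: "B \<in> \<B>"
      and fixB: "T.times_perm g (T.iv h) ` B = B" for g h B
  proof -
    obtain x where x: "x \<in> A" "?bp g = x \<otimes>\<^bsub>?S\<^esub> \<sigma> g" using \<sigma>[OF g] by blast
    obtain x' where x': "x' \<in> A" "?bp h = x' \<otimes>\<^bsub>?S\<^esub> \<sigma> g" using \<sigma>[OF h] eq by auto
    have s: "\<sigma> g \<in> carrier ?S" using \<sigma>[OF g] D_c by blast
    let ?q = "?times g (T.iv h)"
    have "?bp ?q = (x \<otimes>\<^bsub>?S\<^esub> \<sigma> g) \<otimes>\<^bsub>?S\<^esub> inv\<^bsub>?S\<^esub> (x' \<otimes>\<^bsub>?S\<^esub> \<sigma> g)"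
      using g h x x' by (simp add: T.bp_mult T.bp_iv)
    also have "\<dots> = x \<otimes>\<^bsub>?S\<^esub> (\<sigma> g \<otimes>\<^bsub>?S\<^esub> inv\<^bsub>?S\<^esub> \<sigma> g) \<otimes>\<^bsub>?S\<^esub> inv\<^bsub>?S\<^esub> x'"
      using x x' s A_c
      by (simp only: T.Blocks.inv_mult_group T.Blocks.m_assoc T.Blocks.inv_closed T.Blocks.m_closed)
    also have "\<dots> = x \<otimes>\<^bsub>?S\<^esub> inv\<^bsub>?S\<^esub> x'" using x x' s A_c by simp
    also have "\<dots> \<in> A"
      using subgroup.m_closed[OF subA x(1) subgroup.m_inv_closed[OF subA x'(1)]] .
    finally obtain n :: nat where n: "?bp ?q = \<alpha> [^]\<^bsub>?S\<^esub> n" unfolding A_pow by blast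
    hence bp_n: "?bp ?q = ?bp (T.pw a n)" using \<alpha>_pow by simp
    obtain i where i: "B = blk i" using B blk(1) by auto
    have "blk (i + n) = T.pw a n ` B" using C.pw_a_blk i by simp
    also have "\<dots> = ?q ` B" using bp_n T.bp_app[OF B] by metis
    finally have "blk (i + n) = blk i" using fixB i by simp
    hence "[i + n = i] (mod p)" by (simp only: blk(2))
    hence "p dvd n" using cong_add_lcancel_0_nat cong_0_iff by blast
    hence "\<alpha> [^]\<^bsub>?S\<^esub> n = \<one>\<^bsub>?S\<^esub>" using T.Blocks.pow_eq_id[OF \<alpha>_c] ord_\<alpha> by simp
    with n g h show ?thesis by (simp add: T.K_iff_bp)
  qed
  have \<sigma>_K: "\<sigma> g = \<sigma> h" if "g \<in> G" "h \<in> G" "?times g (T.iv h) \<in> T.K" for g h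
    using T.bp_eq_iff[OF that(1,2)] that(3) by (simp add: \<sigma>_def)
  have two_blocks: "g \<in> T.K"
    if "g \<in> G" "B \<in> \<B>" "B' \<in> \<B>" "B \<noteq> B'" "g ` B = B" "g ` B' = B'" for g B B'
  proof -
    have "?bp g \<in> Gbar" using that(1) bpG by blast
    from AGL1_two_fixed_points[OF prime_p emb this that(2,3,4)] that
    have "g ` C = C" if "C \<in> \<B>" for C
      using that T.image_block by (simp add: T.bp_app)
    with that(1) show ?thesis by (simp add: T.K_def)
  qed
  \<comment> \<open>The value set is the complement \<open>D\<close>, which has \<open>d\<close>
    elements.\<close>
  have bound: "3 * card F \<le> card T.K * max 3 d" if "F \<subseteq> G" "intersecting \<Omega> F" for F
  proof -
    have "finite D" using cardD d0 card_ge_0_finite by blast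
    have "3 * card F \<le> card T.K * max 3 (card D)"
    proof (rule L.intersecting_bound[where \<sigma> = \<sigma>])
      show "\<sigma> g \<in> D" if "g \<in> G" for g using \<sigma>[OF that] by blast
    qed (fact that \<open>finite D\<close> \<sigma>_eq \<sigma>_K two_blocks)+
    thus ?thesis by (simp only: cardD)
  qed

  \<comment> \<open>The group G(a,b) is all of G\<close>
  have generated: "generate (BijGroup \<Omega>) (K \<union> {a, b}) = G"
  proof
    let ?H = "generate (BijGroup \<Omega>) (K \<union> {a, b})"
    have sub: "K \<union> {a, b} \<subseteq> G" using K_eq T.K_G aG bG by auto
    show "?H \<subseteq> G" by (rule T.Sym.generate_subgroup_incl[OF sub subG])
    have H: "subgroup ?H (BijGroup \<Omega>)"
      using sub T.G_carrier by (intro T.Sym.generate_is_subgroup) auto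
    have pow_H: "T.pw x n \<in> ?H" if "x \<in> ?H" for x n
      by (induction n) (use that subgroup.one_closed[OF H] subgroup.m_closed[OF H] in auto)
    show "G \<subseteq> ?H"
    proof
      fix g assume g: "g \<in> G"
      hence "?bp g \<in> Gbar" using bpG by blast
      then obtain m n :: nat where mn: "?bp g = \<alpha> [^]\<^bsub>?S\<^esub> m \<otimes>\<^bsub>?S\<^esub> \<beta> [^]\<^bsub>?S\<^esub> n"
        using Gbar_factor unfolding A_pow D_pow by blast
      \<comment> \<open>The factorization of \<open>?bp g\<close> is lifted to powers of
        \<open>a\<close> and \<open>b\<close>; \<open>g\<close> and \<open>h\<close> then differ by
        an element of \<open>K\<close>.\<close>
      define h where "h = ?times (T.pw a m) (T.pw b n)"
      have "a \<in> ?H" "b \<in> ?H" by (auto intro: generate.incl)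
      hence "h \<in> ?H" unfolding h_def by (intro subgroup.m_closed[OF H] pow_H)
      moreover have "h \<in> G" using aG bG by (simp add: h_def)
      ultimately have h: "h \<in> G" "h \<in> ?H" by auto
      have "?bp g = ?bp h"
        using mn aG bG by (simp add: h_def T.bp_mult T.bp_pw bp_a bp_b)
      hence "?times g (T.iv h) \<in> ?H"
        using T.bp_eq_iff[OF g h(1)] K_eq by (auto intro: generate.incl)
      from subgroup.m_closed[OF H this h(2)]
      have "?times (?times g (T.iv h)) h \<in> ?H" .
      also have "?times (?times g (T.iv h)) h = g"
        using g h(1) by (intro T.G_eqI) auto
      finally show "g \<in> ?H" .
    qed
  qed

  \<comment> \<open>Order of the point stabilizer and value of the density\<close>
  define St where "St = {g \<in> G. g \<omega> = \<omega>}"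
  have St: "stabilizer (perm_group \<Omega> G) (\<lambda>g. g) \<omega> = St"
    by (simp add: stabilizer_def St_def)
  have act: "transitive_action (perm_group \<Omega> G) \<Omega> (\<lambda>g. g)"
    using transG by (simp add: transitive_on_def)
  have "orbit (perm_group \<Omega> G) (\<lambda>g. g) \<omega> = \<Omega>"
    using transitive_action.unique_orbit[OF act \<omega>] \<omega> by (fastforce simp: orbit_def)
  \<comment> \<open>Orbit-stabilizer gives |G| = 3 p |St|, and counting cosets of \<open>K\<close>
    gives |G| = |K| p d.\<close>
  with group_action.orbit_stabilizer_theorem[OF transitive_action.axioms(1)[OF act] \<omega>]
  have "3 * p * card St = card G" by (simp add: card_\<Omega> St order_def)
  also have "\<dots> = card T.K * (p * d)" using T.card_G bpG cardGbar by simp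
  finally have card_St: "3 * card St = card T.K * d" using p0 by simp
  have K_pos: "card T.K > 0" using L.finite_K T.K_one unfolding card_gt_0_iff by blast

  let ?M = "{card F |F. F \<subseteq> G \<and> intersecting \<Omega> F}"
  have finM: "finite ?M"
    using T.finite_G by (intro finite_subset[of ?M "card ` Pow G"]) auto
  \<comment> \<open>For \<open>g\<close> and \<open>h\<close> in \<open>K\<close>, a fixed point of
    h^-1 g is a point where they agree.\<close>
  have int_K: "intersecting \<Omega> T.K"
    unfolding intersecting_def
  proof (intro ballI)
    fix g h assume gh: "g \<in> T.K" "h \<in> T.K"
    hence "?times (T.iv h) g \<in> T.K" by simp
    then obtain x where x: "x \<in> \<Omega>" "?times (T.iv h) g x = x" using K_fix by blast
    hence "h (T.iv h (g x)) = h x" using gh by (simp add: T.K_G)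
    thus "\<exists>x\<in>\<Omega>. g x = h x" using x gh by (auto simp: T.K_G)
  qed
  have in_M: "card T.K \<in> ?M" "card St \<in> ?M"
  proof -
    have "T.K \<subseteq> G" "St \<subseteq> G" using T.K_G by (auto simp: St_def)
    moreover have "intersecting \<Omega> St" using \<omega> by (force simp: St_def intersecting_def)
    ultimately show "card T.K \<in> ?M" "card St \<in> ?M" using int_K by blast+
  qed
  have le_M: "card T.K \<le> Max ?M" "card St \<le> Max ?M"
    using Max_ge[OF finM] in_M by auto
  have "Max ?M \<in> ?M" using Max_in[OF finM] in_M by blast
  hence M_le: "3 * Max ?M \<le> card T.K * max 3 d" using bound by force
  have dens: "intersection_density \<Omega> G \<omega> = real (Max ?M) / real (card St)"
    by (simp add: intersection_density_def St)
  \<comment> \<open>For d \<le> 3 the family \<open>K\<close> attains the bound; for larger d the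
    stabilizer does, its order being |K| d / 3.\<close>
  have "intersection_density \<Omega> G \<omega> = max 1 (3 / real d)"
  proof (cases "d \<le> 3")
    case True
    hence M: "Max ?M = card T.K" using M_le le_M by simp
    have "real (3 * card St) = real (card T.K * d)" using card_St by simp
    hence St_eq: "real (card St) = real (card T.K) * real d / 3" by simp
    have "intersection_density \<Omega> G \<omega> = 3 / real d"
      unfolding dens M St_eq using K_pos by simp
    moreover have "1 \<le> 3 / real d" using True d0 by simp
    ultimately show ?thesis by simp
  next
    case False
    hence "Max ?M = card St" using M_le le_M card_St by simp
    moreover have "card St > 0" using card_St K_pos d0 by (cases "card St") auto
    ultimately show ?thesis using False by (simp add: dens max_def field_simps)
  qed
  thus ?thesis unfolding generated .
qed

end
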